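(* Let $(G,\alpha_G)$ be a perfect Hom-Lie algebra with surjective endomorphism $\alpha_G$, and suppose that $H_2^{\alpha}(G\star G)=\mathrm{Im}(\eta)$. Then \[(\mathfrak{uce}(G\star G),\alpha_{\mathfrak{uce}(G\star G)})\cong(\mathfrak{uce}(G)\star\mathfrak{uce}(G),\alpha),\] where $\alpha=\alpha_{\mathfrak{uce}(G)}\star\alpha_{\mathfrak{uce}(G)}$.
   Context: Fix a ground field $\mathbb K$; all vector spaces and (bi)linear maps are over $\mathbb K$. A Hom-Lie algebra $(L,\alpha_L)$ is a vector space $L$ with a bilinear bracket and a linear map $\alpha_L:L\to L$ such that $[x,y]=-[y,x]$ and $[\alpha_L(x),[y,z]]+[\alpha_L(z),[x,y]]+[\alpha_L(y),[z,x]]=0$; all Hom-Lie algebras are assumed multiplicative: $\alpha_L[x,y]=[\alpha_L(x),\alpha_L(y)]$. Homomorphisms are linear maps preserving brackets and commuting with the endomorphisms $\alpha$. $(L,\alpha_L)$ is perfect if $L=[L,L]$. Let $(M,\alpha_M)$, $(N,\alpha_N)$ be Hom-ideals of a Hom-Lie algebra (subspaces stable under the endomorphism and under bracketing with all elements), acting on each other by the bracket: ${}^mn=[m,n]$, ${}^nm=[n,m]$. The non-abelian tensor product $(M\star N,\alpha_{M\star N})$ is the quotient of $M\otimes N$ by the subspace spanned by all elements: (i) $[m,m']\otimes\alpha_N(n)-\alpha_M(m)\otimes{}^{m'}n+\alpha_M(m')\otimes{}^mn$; (ii) $\alpha_M(m)\otimes[n,n']-{}^{n'}m\otimes\alpha_N(n)+{}^nm\otimes\alpha_N(n')$;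 (iii) ${}^nm\otimes{}^mn$; (iv) ${}^nm\otimes{}^{m'}n'+{}^{n'}m'\otimes{}^mn$; (v) $[{}^nm,{}^{n'}m']\otimes\alpha_N({}^{m''}n'')+[{}^{n'}m',{}^{n''}m'']\otimes\alpha_N({}^mn)+[{}^{n''}m'',{}^nm]\otimes\alpha_N({}^{m'}n')$. The class of $m\otimes n$ is $m\star n$; the bracket is $[m\star n,m'\star n']=-{}^nm\star{}^{m'}n'$, and $\alpha_{M\star N}(m\star n)=\alpha_M(m)\star\alpha_N(n)$. It is known that for a perfect $(M,\alpha_M)$ the map $\psi_M:(M\star M,\alpha_{M\star M})\to(M,\alpha_M)$, $\psi_M(m\star m')=[m,m']$, is the universal central extension of $(M,\alpha_M)$ (initial among surjective homomorphisms onto $M$ with central kernel). It is denoted $(\mathfrak{uce}(M),\alpha_{\mathfrak{uce}(M)})$, i.e. $\mathfrak{uce}(M)$ is identified with $M\star M$; its kernel $\mathrm{Ker}(\psi_M)$ is identified with the second homology $H_2^\alpha(M)$ with trivial coefficients, a Hom-ideal of $\mathfrak{uce}(M)$. If $G$ is perfect, then so is $G\star G$. The tensor product $\mathfrak{uce}(G)\star\mathfrak{uce}(G)$ is formed with $\mathfrak{uce}(G)$ acting on itself by its bracket. With these identifications $H_2^\alpha(G\star G)=\mathrm{Ker}(\psi_{G\star G})$ and $\mathrm{Im}(\eta)$ are both subspaces of $(G\star G)\star(G\star G)$. The map $\eta:H\to\mathfrak{uce}(G)\star\mathfrak{uce}(G)$ has domain $H=\big(H_2^\alpha(G)\star\mathfrak{uce}(G)\big)\rtimes\big(\mathfrak{uce}(G)\star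 H_2^\alpha(G)\big)$, a semi-direct product with underlying vector space the direct sum of the two factors, and is given by $\eta(m\star k,\,l\star n)=m\star k+\alpha_{\mathfrak{uce}(G)}(l)\star\alpha_{\mathfrak{uce}(G)}(n)$ for $m,n\in H_2^\alpha(G)$, $k,l\in\mathfrak{uce}(G)$. (The semi-direct product of $X$ and $Y$, with $Y$ acting on $X$, has bracket $[(x_1,y_1),(x_2,y_2)]=([x_1,x_2]+{}^{\alpha_Y(y_1)}x_2-{}^{\alpha_Y(y_2)}x_1,[y_1,y_2])$; here the action is ${}^{(l\star n)}(m\star k)=-[n,l]\star[m,k]$.)
   Formalization: In characteristic 2 the cited fact that M⋆M is the universal central extension fails, so the isomorphism for uce defined by its universal property is stated only for characteristic different from 2; with uce(M) taken to be M⋆M it is stated over every field. *)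

theory Defs
  imports "HOL-Algebra.Module" "HOL-Algebra.AbelCoset" "HOL.Hull"
begin

section \<open>Hom-Lie algebras\<close>

text \<open>
  The record extends the module record of HOL-Algebra, from which only the vector space operations
  are used: the inherited fields \<open>mult\<close> and \<open>one\<close> carry no meaning here and no notion below
  depends on them.
\<close>

record ('k, 'a) hom_lie = "('k, 'a) module" +
  bracket :: "'a \<Rightarrow> 'a \<Rightarrow> 'a"  (\<open>\<lbrakk>_, _\<rbrakk>\<index>\<close>)
  twist :: "'a \<Rightarrow> 'a"

locale hom_lie_algebra = field K + module K L
  for K :: "('k, 'r) ring_scheme" (structure) and L :: "('k, 'a) hom_lie" (structure) +
  assumes bracket_closed: "\<lbrakk>x \<in> carrier L; y \<in> carrier L\<rbrakk> \<Longrightarrow> \<lbrakk>x, y\<rbrakk>\<^bsub>L\<^esub> \<in> carrier L"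
    and bracket_add_left: "\<lbrakk>x \<in> carrier L; y \<in> carrier L; z \<in> carrier L\<rbrakk> \<Longrightarrow>
      \<lbrakk>x \<oplus>\<^bsub>L\<^esub> y, z\<rbrakk>\<^bsub>L\<^esub> = \<lbrakk>x, z\<rbrakk>\<^bsub>L\<^esub> \<oplus>\<^bsub>L\<^esub> \<lbrakk>y, z\<rbrakk>\<^bsub>L\<^esub>"
    and bracket_add_right: "\<lbrakk>x \<in> carrier L; y \<in> carrier L; z \<in> carrier L\<rbrakk> \<Longrightarrow>
      \<lbrakk>x, y \<oplus>\<^bsub>L\<^esub> z\<rbrakk>\<^bsub>L\<^esub> = \<lbrakk>x, y\<rbrakk>\<^bsub>L\<^esub> \<oplus>\<^bsub>L\<^esub> \<lbrakk>x, z\<rbrakk>\<^bsub>L\<^esub>"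
    and bracket_smult_left: "\<lbrakk>a \<in> carrier K; x \<in> carrier L; y \<in> carrier L\<rbrakk> \<Longrightarrow>
      \<lbrakk>a \<odot>\<^bsub>L\<^esub> x, y\<rbrakk>\<^bsub>L\<^esub> = a \<odot>\<^bsub>L\<^esub> \<lbrakk>x, y\<rbrakk>\<^bsub>L\<^esub>"
    and bracket_smult_right: "\<lbrakk>a \<in> carrier K; x \<in> carrier L; y \<in> carrier L\<rbrakk> \<Longrightarrow>
      \<lbrakk>x, a \<odot>\<^bsub>L\<^esub> y\<rbrakk>\<^bsub>L\<^esub> = a \<odot>\<^bsub>L\<^esub> \<lbrakk>x, y\<rbrakk>\<^bsub>L\<^esub>"
    and bracket_skew: "\<lbrakk>x \<in> carrier L; y \<in> carrier L\<rbrakk> \<Longrightarrow> \<lbrakk>x, y\<rbrakk>\<^bsub>L\<^esub> = \<ominus>\<^bsub>L\<^esub> \<lbrakk>y, x\<rbrakk>\<^bsub>L\<^esub>"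
    and hom_jacobi: "\<lbrakk>x \<in> carrier L; y \<in> carrier L; z \<in> carrier L\<rbrakk> \<Longrightarrow>
      \<lbrakk>twist L x, \<lbrakk>y, z\<rbrakk>\<^bsub>L\<^esub>\<rbrakk>\<^bsub>L\<^esub> \<oplus>\<^bsub>L\<^esub> \<lbrakk>twist L z, \<lbrakk>x, y\<rbrakk>\<^bsub>L\<^esub>\<rbrakk>\<^bsub>L\<^esub> \<oplus>\<^bsub>L\<^esub> \<lbrakk>twist L y, \<lbrakk>z, x\<rbrakk>\<^bsub>L\<^esub>\<rbrakk>\<^bsub>L\<^esub> = \<zero>\<^bsub>L\<^esub>"
    and twist_closed: "x \<in> carrier L \<Longrightarrow> twist L x \<in> carrier L"
    and twist_add: "\<lbrakk>x \<in> carrier L; y \<in> carrier L\<rbrakk> \<Longrightarrow>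
      twist L (x \<oplus>\<^bsub>L\<^esub> y) = twist L x \<oplus>\<^bsub>L\<^esub> twist L y"
    and twist_smult: "\<lbrakk>a \<in> carrier K; x \<in> carrier L\<rbrakk> \<Longrightarrow>
      twist L (a \<odot>\<^bsub>L\<^esub> x) = a \<odot>\<^bsub>L\<^esub> twist L x"
    and twist_bracket: "\<lbrakk>x \<in> carrier L; y \<in> carrier L\<rbrakk> \<Longrightarrow>
      twist L \<lbrakk>x, y\<rbrakk>\<^bsub>L\<^esub> = \<lbrakk>twist L x, twist L y\<rbrakk>\<^bsub>L\<^esub>"

definition hom_lie_hom ::
    "('k, 'r) ring_scheme \<Rightarrow> ('k, 'a) hom_lie \<Rightarrow> ('k, 'b) hom_lie \<Rightarrow> ('a \<Rightarrow> 'b) set" where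
  "hom_lie_hom K L L' = {f \<in> carrier L \<rightarrow> carrier L'.
     (\<forall>x\<in>carrier L. \<forall>y\<in>carrier L. f (x \<oplus>\<^bsub>L\<^esub> y) = f x \<oplus>\<^bsub>L'\<^esub> f y) \<and>
     (\<forall>a\<in>carrier K. \<forall>x\<in>carrier L. f (a \<odot>\<^bsub>L\<^esub> x) = a \<odot>\<^bsub>L'\<^esub> f x) \<and>
     (\<forall>x\<in>carrier L. \<forall>y\<in>carrier L. f \<lbrakk>x, y\<rbrakk>\<^bsub>L\<^esub> = \<lbrakk>f x, f y\<rbrakk>\<^bsub>L'\<^esub>) \<and>
     (\<forall>x\<in>carrier L. f (twist L x) = twist L' (f x))}"

definition hom_lie_isomorphic ::
    "('k, 'r) ring_scheme \<Rightarrow> ('k, 'a) hom_lie \<Rightarrow> ('k, 'b) hom_lie \<Rightarrow> bool" where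
  "hom_lie_isomorphic K L L' \<longleftrightarrow> (\<exists>f\<in>hom_lie_hom K L L'. bij_betw f (carrier L) (carrier L'))"

definition perfect :: "('k, 'r) ring_scheme \<Rightarrow> ('k, 'a) hom_lie \<Rightarrow> bool" where
  "perfect K L \<longleftrightarrow>
     carrier L = (\<lambda>H. submodule H K L) hull {\<lbrakk>x, y\<rbrakk>\<^bsub>L\<^esub> | x y. x \<in> carrier L \<and> y \<in> carrier L}"


section \<open>Central extensions\<close>

definition central_extension ::
    "('k, 'r) ring_scheme \<Rightarrow> ('k, 'c) hom_lie \<Rightarrow> ('c \<Rightarrow> 'a) \<Rightarrow> ('k, 'a) hom_lie \<Rightarrow> bool" where
  "central_extension K C c L \<longleftrightarrow>
     hom_lie_algebra K C \<and> hom_lie_algebra K L \<and>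
     c \<in> hom_lie_hom K C L \<and> c ` carrier C = carrier L \<and>
     (\<forall>x\<in>a_kernel C L c. \<forall>y\<in>carrier C. \<lbrakk>x, y\<rbrakk>\<^bsub>C\<^esub> = \<zero>\<^bsub>C\<^esub>)"

text \<open>
  HOL cannot quantify over types inside a formula, so the type \<open>'c\<close> of the elements of the central
  extensions against which \<open>(U, u)\<close> is tested is a parameter.
\<close>

definition universal_central_extension ::
    "'c itself \<Rightarrow> ('k, 'r) ring_scheme \<Rightarrow> ('k, 'u) hom_lie \<Rightarrow> ('u \<Rightarrow> 'a) \<Rightarrow> ('k, 'a) hom_lie \<Rightarrow> bool"
  where
  "universal_central_extension (_ :: 'c itself) K U u L \<longleftrightarrow>
     central_extension K U u L \<and>
     (\<forall>(C :: ('k, 'c) hom_lie) c. central_extension K C c L \<longrightarrow>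
        (\<exists>!f. f \<in> hom_lie_hom K U C \<and> f \<in> extensional (carrier U) \<and>
              (\<forall>x\<in>carrier U. c (f x) = u x)))"


section \<open>The non-abelian tensor product\<close>

text \<open>
  \<open>M\<close> and \<open>N\<close> are (the carriers of) Hom-ideals of \<open>L\<close> that act on each other by the bracket of
  \<open>L\<close>. The quotient of \<open>M \<otimes> N\<close> by the span of \<open>hom_lie_relations\<close> is formed in one step, as the
  quotient of the vector space of finitely supported \<open>K\<close>-valued functions on \<open>M \<times> N\<close> by the span
  of \<open>bilinear_relations\<close> and \<open>hom_lie_relations\<close> together.
\<close>

definition free_space ::
    "('k, 'r) ring_scheme \<Rightarrow> 'p set \<Rightarrow> ('k, 'p \<Rightarrow> 'k) module" where
  "free_space K S =
     \<lparr>carrier = {f. (\<forall>p. f p \<in> carrier K) \<and> finite {p. f p \<noteq> \<zero>\<^bsub>K\<^esub>} \<and> {p. f p \<noteq> \<zero>\<^bsub>K\<^esub>} \<subseteq> S},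
      mult = undefined, one = undefined,
      zero = (\<lambda>p. \<zero>\<^bsub>K\<^esub>), add = (\<lambda>f g p. f p \<oplus>\<^bsub>K\<^esub> g p),
      smult = (\<lambda>a f p. a \<otimes>\<^bsub>K\<^esub> f p)\<rparr>"

definition point :: "('k, 'r) ring_scheme \<Rightarrow> 'a \<Rightarrow> 'b \<Rightarrow> 'a \<times> 'b \<Rightarrow> 'k" where
  "point K m n = (\<lambda>p. if p = (m, n) then \<one>\<^bsub>K\<^esub> else \<zero>\<^bsub>K\<^esub>)"

definition bilinear_relations ::
    "('k, 'r) ring_scheme \<Rightarrow> ('k, 'a) hom_lie \<Rightarrow> 'a set \<Rightarrow> 'a set \<Rightarrow> ('a \<times> 'a \<Rightarrow> 'k) set" where
  "bilinear_relations K L M N = (let F = free_space K (M \<times> N); t = point K in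
     {t (m \<oplus>\<^bsub>L\<^esub> m') n \<ominus>\<^bsub>F\<^esub> t m n \<ominus>\<^bsub>F\<^esub> t m' n | m m' n. m \<in> M \<and> m' \<in> M \<and> n \<in> N} \<union>
     {t m (n \<oplus>\<^bsub>L\<^esub> n') \<ominus>\<^bsub>F\<^esub> t m n \<ominus>\<^bsub>F\<^esub> t m n' | m n n'. m \<in> M \<and> n \<in> N \<and> n' \<in> N} \<union>
     {t (a \<odot>\<^bsub>L\<^esub> m) n \<ominus>\<^bsub>F\<^esub> a \<odot>\<^bsub>F\<^esub> t m n | a m n. a \<in> carrier K \<and> m \<in> M \<and> n \<in> N} \<union>
     {t m (a \<odot>\<^bsub>L\<^esub> n) \<ominus>\<^bsub>F\<^esub> a \<odot>\<^bsub>F\<^esub> t m n | a m n. a \<in> carrier K \<and> m \<in> M \<and> n \<in> N})"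

text \<open>The actions \<open>\<^sup>nm = [n, m]\<close> and \<open>\<^sup>mn = [m, n]\<close> are written out as brackets of \<open>L\<close>.\<close>

definition hom_lie_relations ::
    "('k, 'r) ring_scheme \<Rightarrow> ('k, 'a) hom_lie \<Rightarrow> 'a set \<Rightarrow> 'a set \<Rightarrow> ('a \<times> 'a \<Rightarrow> 'k) set" where
  "hom_lie_relations K L M N =
    (let F = free_space K (M \<times> N); t = point K; B = bracket L; \<alpha> = twist L in
     {t (B m m') (\<alpha> n) \<ominus>\<^bsub>F\<^esub> t (\<alpha> m) (B m' n) \<oplus>\<^bsub>F\<^esub> t (\<alpha> m') (B m n)
       | m m' n. m \<in> M \<and> m' \<in> M \<and> n \<in> N} \<union>
     {t (\<alpha> m) (B n n') \<ominus>\<^bsub>F\<^esub> t (B n' m) (\<alpha> n) \<oplus>\<^bsub>F\<^esub> t (B n m) (\<alpha> n')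
       | m n n'. m \<in> M \<and> n \<in> N \<and> n' \<in> N} \<union>
     {t (B n m) (B m n) | m n. m \<in> M \<and> n \<in> N} \<union>
     {t (B n m) (B m' n') \<oplus>\<^bsub>F\<^esub> t (B n' m') (B m n)
       | m n m' n'. m \<in> M \<and> n \<in> N \<and> m' \<in> M \<and> n' \<in> N} \<union>
     {t (B (B n m) (B n' m')) (\<alpha> (B m'' n'')) \<oplus>\<^bsub>F\<^esub>
      t (B (B n' m') (B n'' m'')) (\<alpha> (B m n)) \<oplus>\<^bsub>F\<^esub>
      t (B (B n'' m'') (B n m)) (\<alpha> (B m' n'))
       | m n m' n' m'' n''.
         m \<in> M \<and> n \<in> N \<and> m' \<in> M \<and> n' \<in> N \<and> m'' \<in> M \<and> n'' \<in> N})"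

definition star_null ::
    "('k, 'r) ring_scheme \<Rightarrow> ('k, 'a) hom_lie \<Rightarrow> 'a set \<Rightarrow> 'a set \<Rightarrow> ('a \<times> 'a \<Rightarrow> 'k) set" where
  "star_null K L M N = (\<lambda>H. submodule H K (free_space K (M \<times> N))) hull
     (bilinear_relations K L M N \<union> hom_lie_relations K L M N)"

type_synonym ('k, 'a) star_elem = "('a \<times> 'a \<Rightarrow> 'k) set"

text \<open>
  In the scalar multiplication of cosets, adding \<open>star_null\<close> matters only for the scalar \<open>0\<close>.
\<close>

definition star_space ::
    "('k, 'r) ring_scheme \<Rightarrow> ('k, 'a) hom_lie \<Rightarrow> 'a set \<Rightarrow> 'a set \<Rightarrow> ('k, ('k, 'a) star_elem) module"
  where
  "star_space K L M N = (let F = free_space K (M \<times> N); R = star_null K L M N in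
     \<lparr>carrier = a_rcosets\<^bsub>F\<^esub> R, mult = undefined, one = undefined,
      zero = R, add = set_add F,
      smult = (\<lambda>a c. ((\<lambda>f. a \<odot>\<^bsub>F\<^esub> f) ` c) <+>\<^bsub>F\<^esub> R)\<rparr>)"

definition star_elt ::
    "('k, 'r) ring_scheme \<Rightarrow> ('k, 'a) hom_lie \<Rightarrow> 'a set \<Rightarrow> 'a set \<Rightarrow> 'a \<Rightarrow> 'a \<Rightarrow> ('k, 'a) star_elem"
  where
  "star_elt K L M N m n = star_null K L M N +>\<^bsub>free_space K (M \<times> N)\<^esub> point K m n"

text \<open>
  The linear map from a tensor product to \<open>X\<close> with \<open>m \<star> n \<mapsto> b m n\<close>, for a bilinear \<open>b\<close> that is
  compatible with the relations: the linear extension of \<open>b\<close> to the free space is then constant on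
  each coset, and its value on the coset is taken.
\<close>

definition star_lift ::
    "('k, 'r) ring_scheme \<Rightarrow> ('k, 'x, 'm) module_scheme \<Rightarrow> ('a \<Rightarrow> 'a \<Rightarrow> 'x) \<Rightarrow>
     ('k, 'a) star_elem \<Rightarrow> 'x" where
  "star_lift K X b c = the_elem
     ((\<lambda>f. \<Oplus>\<^bsub>X\<^esub>p\<in>{p. f p \<noteq> \<zero>\<^bsub>K\<^esub>}. f p \<odot>\<^bsub>X\<^esub> b (fst p) (snd p)) ` c)"

definition star ::
    "('k, 'r) ring_scheme \<Rightarrow> ('k, 'a) hom_lie \<Rightarrow> 'a set \<Rightarrow> 'a set \<Rightarrow> ('k, ('k, 'a) star_elem) hom_lie"
  where
  "star K L M N = (let Q = star_space K L M N; s = star_elt K L M N in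
     \<lparr>carrier = carrier Q, mult = mult Q, one = one Q, zero = zero Q, add = add Q, smult = smult Q,
      bracket = (\<lambda>c d.
        star_lift K Q (\<lambda>m n.
          star_lift K Q (\<lambda>m' n'. \<ominus>\<^bsub>Q\<^esub> s \<lbrakk>n, m\<rbrakk>\<^bsub>L\<^esub> \<lbrakk>m', n'\<rbrakk>\<^bsub>L\<^esub>) d) c),
      twist = star_lift K Q (\<lambda>m n. s (twist L m) (twist L n))\<rparr>)"

definition star_square ::
    "('k, 'r) ring_scheme \<Rightarrow> ('k, 'a) hom_lie \<Rightarrow> ('k, ('k, 'a) star_elem) hom_lie" where
  "star_square K L = star K L (carrier L) (carrier L)"


section \<open>The model of the universal central extension\<close>

text \<open>
  For perfect \<open>M\<close>, \<open>uce K M\<close> with the projection \<open>uce_map K M\<close> (the map \<open>m \<star> m' \<mapsto> [m, m']\<close>) is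
  the identification of the universal central extension with \<open>M \<star> M\<close>, and \<open>H2 K M\<close> is the
  corresponding identification of the second homology with trivial coefficients. In characteristic
  2 this requires in addition that the bracket of \<open>M\<close> be alternating.
\<close>

definition uce ::
    "('k, 'r) ring_scheme \<Rightarrow> ('k, 'a) hom_lie \<Rightarrow> ('k, ('k, 'a) star_elem) hom_lie" where
  "uce K M = star_square K M"

definition uce_map ::
    "('k, 'r) ring_scheme \<Rightarrow> ('k, 'a) hom_lie \<Rightarrow> ('k, 'a) star_elem \<Rightarrow> 'a" where
  "uce_map K M = star_lift K M (\<lambda>m m'. \<lbrakk>m, m'\<rbrakk>\<^bsub>M\<^esub>)"

definition H2 ::
    "('k, 'r) ring_scheme \<Rightarrow> ('k, 'a) hom_lie \<Rightarrow> ('k, 'a) star_elem set" where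
  "H2 K M = a_kernel (uce K M) M (uce_map K M)"


section \<open>The map \<open>\<eta>\<close>\<close>

definition semidirect ::
    "('k, 'x) hom_lie \<Rightarrow> ('k, 'y) hom_lie \<Rightarrow> ('y \<Rightarrow> 'x \<Rightarrow> 'x) \<Rightarrow> ('k, 'x \<times> 'y) hom_lie" where
  "semidirect X Y act =
     \<lparr>carrier = carrier X \<times> carrier Y, mult = undefined, one = undefined,
      zero = (\<zero>\<^bsub>X\<^esub>, \<zero>\<^bsub>Y\<^esub>),
      add = (\<lambda>(x1, y1) (x2, y2). (x1 \<oplus>\<^bsub>X\<^esub> x2, y1 \<oplus>\<^bsub>Y\<^esub> y2)),
      smult = (\<lambda>a (x, y). (a \<odot>\<^bsub>X\<^esub> x, a \<odot>\<^bsub>Y\<^esub> y)),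
      bracket = (\<lambda>(x1, y1) (x2, y2).
        (\<lbrakk>x1, x2\<rbrakk>\<^bsub>X\<^esub> \<oplus>\<^bsub>X\<^esub> act (twist Y y1) x2 \<ominus>\<^bsub>X\<^esub> act (twist Y y2) x1, \<lbrakk>y1, y2\<rbrakk>\<^bsub>Y\<^esub>)),
      twist = (\<lambda>(x, y). (twist X x, twist Y y))\<rparr>"

definition eta_domain ::
    "('k, 'r) ring_scheme \<Rightarrow> ('k, 'a) hom_lie \<Rightarrow>
     ('k, ('k, ('k, 'a) star_elem) star_elem \<times> ('k, ('k, 'a) star_elem) star_elem) hom_lie" where
  "eta_domain K G =
    (let U = uce K G; X = star K U (H2 K G) (carrier U); Y = star K U (carrier U) (H2 K G) in
     semidirect X Y (\<lambda>y x.
       star_lift K X (\<lambda>l n.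
         star_lift K X (\<lambda>m k.
           \<ominus>\<^bsub>X\<^esub> star_elt K U (H2 K G) (carrier U) \<lbrakk>n, l\<rbrakk>\<^bsub>U\<^esub> \<lbrakk>m, k\<rbrakk>\<^bsub>U\<^esub>) x) y))"

definition eta ::
    "('k, 'r) ring_scheme \<Rightarrow> ('k, 'a) hom_lie \<Rightarrow>
     ('k, ('k, 'a) star_elem) star_elem \<times> ('k, ('k, 'a) star_elem) star_elem \<Rightarrow>
     ('k, ('k, 'a) star_elem) star_elem" where
  "eta K G = (\<lambda>(x, y).
    let U = uce K G; T = star_square K U; s = star_elt K U (carrier U) (carrier U) in
     star_lift K T (\<lambda>m k. s m k) x \<oplus>\<^bsub>T\<^esub>
     star_lift K T (\<lambda>l n. s (twist U l) (twist U n)) y)"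

end

theory Submission
  imports Defs
begin

text \<open>
  The first isomorphism is an identity, because \<open>uce K M\<close> is the object \<open>star_square K M\<close>. For the
  second one, let \<open>M\<close> be perfect over a field of characteristic other than 2, and let
  \<open>\<psi> (m \<star> n) = [m, n]\<close>. The bracket of \<open>M \<star> M\<close> is \<open>[c, d] = \<psi> c \<star> \<psi> d\<close>; hence the kernel of \<open>\<psi>\<close> is
  central, and \<open>M \<star> M\<close> is again perfect since every \<open>m \<star> n\<close> is a bracket. Given a central extension
  \<open>c : C \<rightarrow> M\<close>, the bracket of \<open>C\<close> depends only on the images of its arguments in \<open>M\<close>, so it descends
  to a map on \<open>M \<times> M\<close> that satisfies the relations of the tensor product; this gives the unique
  \<open>M \<star> M \<rightarrow> C\<close> over \<open>M\<close>. So \<open>M \<star> M\<close> is a universal central extension of \<open>M\<close>. With \<open>U = G \<star> G\<close>, this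
  yields \<open>W \<cong> U\<close> and \<open>V \<cong> U \<star> U\<close>, and \<open>W \<star> W\<close>, being universal over \<open>W \<cong> U\<close>, is isomorphic to
  \<open>U \<star> U\<close>.
\<close>

section \<open>Linear maps and quotients\<close>

definition linear_map ::
    "('k, 'r) ring_scheme \<Rightarrow> ('k, 'x, 'm) module_scheme \<Rightarrow> ('k, 'y, 'n) module_scheme \<Rightarrow> ('x \<Rightarrow> 'y) set"
  where
  "linear_map K X Y = {h \<in> carrier X \<rightarrow> carrier Y.
     (\<forall>x\<in>carrier X. \<forall>y\<in>carrier X. h (x \<oplus>\<^bsub>X\<^esub> y) = h x \<oplus>\<^bsub>Y\<^esub> h y) \<and>
     (\<forall>a\<in>carrier K. \<forall>x\<in>carrier X. h (a \<odot>\<^bsub>X\<^esub> x) = a \<odot>\<^bsub>Y\<^esub> h x)}"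

lemma linear_mapI:
  assumes "\<And>x. x \<in> carrier X \<Longrightarrow> h x \<in> carrier Y"
    and "\<And>x y. \<lbrakk>x \<in> carrier X; y \<in> carrier X\<rbrakk> \<Longrightarrow> h (x \<oplus>\<^bsub>X\<^esub> y) = h x \<oplus>\<^bsub>Y\<^esub> h y"
    and "\<And>a x. \<lbrakk>a \<in> carrier K; x \<in> carrier X\<rbrakk> \<Longrightarrow> h (a \<odot>\<^bsub>X\<^esub> x) = a \<odot>\<^bsub>Y\<^esub> h x"
  shows "h \<in> linear_map K X Y"
  using assms by (auto simp: linear_map_def)

lemma linear_map_closed: "\<lbrakk>h \<in> linear_map K X Y; x \<in> carrier X\<rbrakk> \<Longrightarrow> h x \<in> carrier Y"
  and linear_map_add: "\<lbrakk>h \<in> linear_map K X Y; x \<in> carrier X; y \<in> carrier X\<rbrakk> \<Longrightarrow>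
    h (x \<oplus>\<^bsub>X\<^esub> y) = h x \<oplus>\<^bsub>Y\<^esub> h y"
  and linear_map_smult: "\<lbrakk>h \<in> linear_map K X Y; a \<in> carrier K; x \<in> carrier X\<rbrakk> \<Longrightarrow>
    h (a \<odot>\<^bsub>X\<^esub> x) = a \<odot>\<^bsub>Y\<^esub> h x"
  by (auto simp: linear_map_def)

lemma linear_map_compose:
  assumes "h \<in> linear_map K X Y" and "g \<in> linear_map K Y Z"
  shows "(\<lambda>x. g (h x)) \<in> linear_map K X Z"
  using assms by (auto simp: linear_map_def Pi_def)

lemma linear_map_zero:
  assumes "module K X" and "module K Y" and "h \<in> linear_map K X Y"
  shows "h \<zero>\<^bsub>X\<^esub> = \<zero>\<^bsub>Y\<^esub>"
proof -
  interpret X: module K X by fact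
  interpret Y: module K Y by fact
  have "h (\<zero>\<^bsub>K\<^esub> \<odot>\<^bsub>X\<^esub> \<zero>\<^bsub>X\<^esub>) = \<zero>\<^bsub>K\<^esub> \<odot>\<^bsub>Y\<^esub> h \<zero>\<^bsub>X\<^esub>"
    using assms(3) by (intro linear_map_smult) auto
  then show ?thesis
    using linear_map_closed[OF assms(3)] by simp
qed

lemma linear_map_uminus:
  assumes "module K X" and "module K Y" and h: "h \<in> linear_map K X Y" and x: "x \<in> carrier X"
  shows "h (\<ominus>\<^bsub>X\<^esub> x) = \<ominus>\<^bsub>Y\<^esub> h x"
proof -
  interpret X: module K X by fact
  interpret Y: module K Y by fact
  have "h (\<ominus>\<^bsub>X\<^esub> x) \<oplus>\<^bsub>Y\<^esub> h x = h (\<ominus>\<^bsub>X\<^esub> x \<oplus>\<^bsub>X\<^esub> x)"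
    using x by (simp add: linear_map_add[OF h])
  also have "\<dots> = \<zero>\<^bsub>Y\<^esub>"
    using x linear_map_zero[OF assms(1-3)] by (simp add: X.l_neg)
  finally show ?thesis
    using x linear_map_closed[OF h] by (simp add: Y.minus_equality)
qed

lemma linear_map_minus:
  assumes "module K X" and "module K Y" and h: "h \<in> linear_map K X Y"
    and "x \<in> carrier X" and "y \<in> carrier X"
  shows "h (x \<ominus>\<^bsub>X\<^esub> y) = h x \<ominus>\<^bsub>Y\<^esub> h y"
proof -
  interpret X: module K X by fact
  interpret Y: module K Y by fact
  show ?thesis
    using assms by (simp add: a_minus_def linear_map_add linear_map_uminus)
qed

text \<open>Equality of linear maps is reduced below to generators by minimality: a submodule that
  contains generators contains their span. With the zero map as \<open>g\<close> this yields the
  kernel of \<open>h\<close>.\<close>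

lemma submodule_equalizer:
  assumes "module K X" and "module K Y" and h: "h \<in> linear_map K X Y" and g: "g \<in> linear_map K X Y"
  shows "submodule {x \<in> carrier X. h x = g x} K X"
proof -
  interpret X: module K X by fact
  interpret Y: module K Y by fact
  show ?thesis
    by (rule X.submoduleI)
       (auto simp: linear_map_zero[OF assms(1,2)] h g linear_map_uminus[OF assms(1,2)]
         linear_map_add[OF h] linear_map_add[OF g] linear_map_smult[OF h] linear_map_smult[OF g])
qed

lemma linear_map_const_zero:
  assumes "module K Y"
  shows "(\<lambda>x. \<zero>\<^bsub>Y\<^esub>) \<in> linear_map K X Y"
proof -
  interpret Y: module K Y by fact
  show ?thesis by (rule linear_mapI) auto
qed

lemma submodule_vimage:
  assumes "module K X" and "module K Y" and h: "h \<in> linear_map K X Y" and H: "submodule H K Y"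
  shows "submodule {x \<in> carrier X. h x \<in> H} K X"
proof -
  interpret X: module K X by fact
  interpret Y: module K Y by fact
  note E = Y.submoduleE[OF H]
  have "\<zero>\<^bsub>Y\<^esub> \<in> H"
    using submodule.axioms(1)[OF H] subgroup.one_closed by fastforce
  then show ?thesis
    using E by (intro X.submoduleI)
       (auto simp: linear_map_zero[OF assms(1,2)] h linear_map_uminus[OF assms(1,2)]
         linear_map_add[OF h] linear_map_smult[OF h])
qed

lemma submodule_image:
  assumes "module K X" and "module K Y" and h: "h \<in> linear_map K X Y"
  shows "submodule (h ` carrier X) K Y"
proof -
  interpret X: module K X by fact
  interpret Y: module K Y by fact
  have 1: "\<zero>\<^bsub>Y\<^esub> = h \<zero>\<^bsub>X\<^esub>" using linear_map_zero[OF assms] by simp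
  show ?thesis
    by (rule Y.submoduleI)
      (auto simp: 1 linear_map_closed[OF h] linear_map_uminus[OF assms, symmetric]
         linear_map_add[OF h, symmetric] linear_map_smult[OF h, symmetric])
qed

text \<open>Intersections of submodules are submodules. The hypothesis on \<open>S\<close> puts the
  carrier among the intersected sets, so the family is not empty and the hull stays inside the
  carrier.\<close>

lemma submodule_hull:
  assumes "module K X" and S: "S \<subseteq> carrier X"
  shows "submodule ((\<lambda>H. submodule H K X) hull S) K X"
proof -
  interpret X: module K X by fact
  have zero: "\<zero>\<^bsub>X\<^esub> \<in> H" if "submodule H K X" for H
    using submodule.axioms(1)[OF that] subgroup.one_closed by fastforce
  show ?thesis
    unfolding hull_def
    using X.carrier_is_submodule S
    by (intro X.submoduleI) (auto simp: X.submoduleE zero)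
qed

text \<open>Needed because \<open>star\<close> copies the operations of \<open>star_space\<close>
  into a larger record.\<close>

lemma module_cong:
  assumes X: "module K X" and Y: "carrier Y = carrier X" "zero Y = zero X" "add Y = add X"
    "smult Y = smult X"
  shows "module K Y"
proof -
  interpret X: module K X by fact
  show ?thesis
  proof (rule moduleI)
    show "abelian_group Y"
      by (rule abelian_groupI)
        (auto simp: Y X.a_ac intro: bexI[of _ "\<ominus>\<^bsub>X\<^esub> x" for x] X.l_neg)
  qed (auto simp: Y X.smult_l_distr X.smult_r_distr X.smult_assoc1 X.R.is_cring)
qed

text \<open>The quotient space in the form in which it occurs in \<open>star_space\<close>.\<close>

definition quotient_space :: "('k, 'x) module \<Rightarrow> 'x set \<Rightarrow> ('k, 'x set) module" where
  "quotient_space F R =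
     \<lparr>carrier = a_rcosets\<^bsub>F\<^esub> R, mult = undefined, one = undefined,
      zero = R, add = set_add F,
      smult = (\<lambda>a c. ((\<lambda>f. a \<odot>\<^bsub>F\<^esub> f) ` c) <+>\<^bsub>F\<^esub> R)\<rparr>"

lemma
  assumes "module K F" and R: "submodule R K F"
  shows quotient_space_module: "module K (quotient_space F R)"
    and quotient_map_linear: "(\<lambda>f. R +>\<^bsub>F\<^esub> f) \<in> linear_map K F (quotient_space F R)"
    and quotient_space_carrier: "carrier (quotient_space F R) = (\<lambda>f. R +>\<^bsub>F\<^esub> f) ` carrier F"
    and quotient_map_null: "r \<in> R \<Longrightarrow> R +>\<^bsub>F\<^esub> r = \<zero>\<^bsub>quotient_space F R\<^esub>"
proof -
  interpret F: module K F by fact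
  interpret R: submodule R K F by fact
  have sub: "additive_subgroup R F"
    by (rule additive_subgroupI) (rule R.subgroup_axioms)
  interpret AS: abelian_subgroup R F
    by (rule abelian_subgroupI3[OF sub]) unfold_locales
  let ?Q = "quotient_space F R" and ?q = "\<lambda>f. R +>\<^bsub>F\<^esub> f"
  show carr: "carrier ?Q = ?q ` carrier F"
    by (auto simp: quotient_space_def A_RCOSETS_def')
  have add: "?q x \<oplus>\<^bsub>?Q\<^esub> ?q y = ?q (x \<oplus>\<^bsub>F\<^esub> y)" if "x \<in> carrier F" "y \<in> carrier F" for x y
    using AS.a_rcos_sum[OF that] by (simp add: quotient_space_def)
  have smult: "a \<odot>\<^bsub>?Q\<^esub> ?q x = ?q (a \<odot>\<^bsub>F\<^esub> x)" if a: "a \<in> carrier K" and x: "x \<in> carrier F" for a x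
  proof -
    have "?q (a \<odot>\<^bsub>F\<^esub> x) \<subseteq> ((\<lambda>f. a \<odot>\<^bsub>F\<^esub> f) ` ?q x) <+>\<^bsub>F\<^esub> R"
    proof
      fix z assume "z \<in> ?q (a \<odot>\<^bsub>F\<^esub> x)"
      then obtain r where r: "r \<in> R" "z = r \<oplus>\<^bsub>F\<^esub> a \<odot>\<^bsub>F\<^esub> x"
        by (auto simp: a_r_coset_def')
      \<comment> \<open>The representative \<open>x\<close> itself is scaled and all of
        \<open>r\<close> is left to the added summand \<open>R\<close>, so no division by
        \<open>a\<close> is needed.\<close>
      have "x \<in> ?q x" using x by (rule AS.a_rcos_self)
      moreover have "z = a \<odot>\<^bsub>F\<^esub> x \<oplus>\<^bsub>F\<^esub> r"
        using r a x AS.a_Hcarr by (simp add: F.a_comm)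
      ultimately show "z \<in> ((\<lambda>f. a \<odot>\<^bsub>F\<^esub> f) ` ?q x) <+>\<^bsub>F\<^esub> R"
        using r by (auto simp: set_add_def')
    qed
    moreover have "((\<lambda>f. a \<odot>\<^bsub>F\<^esub> f) ` ?q x) <+>\<^bsub>F\<^esub> R \<subseteq> ?q (a \<odot>\<^bsub>F\<^esub> x)"
    proof
      fix z assume "z \<in> ((\<lambda>f. a \<odot>\<^bsub>F\<^esub> f) ` ?q x) <+>\<^bsub>F\<^esub> R"
      then obtain r r' where r: "r \<in> R" "r' \<in> R" "z = a \<odot>\<^bsub>F\<^esub> (r' \<oplus>\<^bsub>F\<^esub> x) \<oplus>\<^bsub>F\<^esub> r"
        by (auto simp: set_add_def' a_r_coset_def')
      have "z = (a \<odot>\<^bsub>F\<^esub> r' \<oplus>\<^bsub>F\<^esub> r) \<oplus>\<^bsub>F\<^esub> a \<odot>\<^bsub>F\<^esub> x"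
        using r a x AS.a_Hcarr by (simp add: F.smult_r_distr F.a_ac)
      moreover have "a \<odot>\<^bsub>F\<^esub> r' \<oplus>\<^bsub>F\<^esub> r \<in> R"
        using r a by auto
      ultimately show "z \<in> ?q (a \<odot>\<^bsub>F\<^esub> x)"
        by (auto simp: a_r_coset_def')
    qed
    ultimately show ?thesis by (simp add: quotient_space_def)
  qed
  have zero: "\<zero>\<^bsub>?Q\<^esub> = ?q \<zero>\<^bsub>F\<^esub>"
    using AS.a_subset by (simp add: quotient_space_def)
  show "?q \<in> linear_map K F ?Q"
    by (rule linear_mapI) (auto simp: carr add smult)
  show "?q r = \<zero>\<^bsub>?Q\<^esub>" if "r \<in> R"
    using F.a_coset_join2[OF _ R.subgroup_axioms that] AS.a_Hcarr[OF that]
    by (simp add: quotient_space_def)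
  show "module K ?Q"
  proof (rule moduleI)
    show "cring K" by unfold_locales
    show "abelian_group ?Q"
    proof (rule abelian_groupI)
      show "\<exists>y\<in>carrier ?Q. y \<oplus>\<^bsub>?Q\<^esub> x = \<zero>\<^bsub>?Q\<^esub>" if x: "x \<in> carrier ?Q" for x
      proof -
        obtain f where "f \<in> carrier F" "x = ?q f" using x carr by auto
        then show ?thesis
          by (intro bexI[of _ "?q (\<ominus>\<^bsub>F\<^esub> f)"]) (auto simp: carr add zero F.l_neg)
      qed
    qed (auto simp: carr add zero F.a_ac)
  qed (auto simp: carr add smult F.smult_l_distr F.smult_r_distr F.smult_assoc1)
qed


section \<open>The free space\<close>

text \<open>This is the map whose image of a coset \<open>star_lift\<close> collapses to one
  element. Here \<open>b\<close> takes an index of any type; a curried map is supplied later as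
  \<open>case_prod b\<close>.\<close>

definition linear_extension ::
    "('k, 'r) ring_scheme \<Rightarrow> ('k, 'x, 'm) module_scheme \<Rightarrow> ('p \<Rightarrow> 'x) \<Rightarrow> ('p \<Rightarrow> 'k) \<Rightarrow> 'x" where
  "linear_extension K X b f = (\<Oplus>\<^bsub>X\<^esub>p\<in>{p. f p \<noteq> \<zero>\<^bsub>K\<^esub>}. f p \<odot>\<^bsub>X\<^esub> b p)"

definition unit_vector :: "('k, 'r) ring_scheme \<Rightarrow> 'p \<Rightarrow> 'p \<Rightarrow> 'k" where
  "unit_vector K p = (\<lambda>q. if q = p then \<one>\<^bsub>K\<^esub> else \<zero>\<^bsub>K\<^esub>)"

lemma free_space_carrier:
  "f \<in> carrier (free_space K S) \<longleftrightarrow>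
     (\<forall>p. f p \<in> carrier K) \<and> finite {p. f p \<noteq> \<zero>\<^bsub>K\<^esub>} \<and> {p. f p \<noteq> \<zero>\<^bsub>K\<^esub>} \<subseteq> S"
  by (simp add: free_space_def)

text \<open>Pointwise unfolding suits the proofs of this section but hides the linear structure, so
  several later proofs remove these rules from the simplifier.\<close>

lemma free_space_ops [simp]:
  "\<zero>\<^bsub>free_space K S\<^esub> = (\<lambda>p. \<zero>\<^bsub>K\<^esub>)"
  "f \<oplus>\<^bsub>free_space K S\<^esub> g = (\<lambda>p. f p \<oplus>\<^bsub>K\<^esub> g p)"
  "a \<odot>\<^bsub>free_space K S\<^esub> f = (\<lambda>p. a \<otimes>\<^bsub>K\<^esub> f p)"
  by (simp_all add: free_space_def)

lemma free_space_module:
  assumes "cring K"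
  shows "module K (free_space K S)"
proof -
  interpret K: cring K by fact
  let ?F = "free_space K S"
  have add: "(\<lambda>p. f p \<oplus>\<^bsub>K\<^esub> g p) \<in> carrier ?F" if "f \<in> carrier ?F" "g \<in> carrier ?F" for f g
  proof -
    have "{p. f p \<oplus>\<^bsub>K\<^esub> g p \<noteq> \<zero>\<^bsub>K\<^esub>} \<subseteq> {p. f p \<noteq> \<zero>\<^bsub>K\<^esub>} \<union> {p. g p \<noteq> \<zero>\<^bsub>K\<^esub>}"
      using that by (auto simp: free_space_carrier)
    then show ?thesis
      using that unfolding free_space_carrier
      by (metis (no_types, lifting) K.add.m_closed Un_least finite_UnI finite_subset order_trans)
  qed
  have smult: "(\<lambda>p. a \<otimes>\<^bsub>K\<^esub> f p) \<in> carrier ?F" if "a \<in> carrier K" "f \<in> carrier ?F" for a f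
  proof -
    have "{p. a \<otimes>\<^bsub>K\<^esub> f p \<noteq> \<zero>\<^bsub>K\<^esub>} \<subseteq> {p. f p \<noteq> \<zero>\<^bsub>K\<^esub>}"
      using that by (auto simp: free_space_carrier)
    then show ?thesis
      using that unfolding free_space_carrier
      by (metis (no_types, lifting) K.m_closed finite_subset order_trans)
  qed
  show ?thesis
  proof (rule moduleI)
    show "abelian_group ?F"
    proof (rule abelian_groupI)
      show "\<exists>g\<in>carrier ?F. g \<oplus>\<^bsub>?F\<^esub> f = \<zero>\<^bsub>?F\<^esub>" if f: "f \<in> carrier ?F" for f
      proof
        \<comment> \<open>The negative is taken as a multiple by minus one, so that its finite
          support follows from closure under scalars.\<close>
        show "(\<lambda>p. \<ominus>\<^bsub>K\<^esub> \<one>\<^bsub>K\<^esub> \<otimes>\<^bsub>K\<^esub> f p) \<in> carrier ?F"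
          using smult[OF _ f] by simp
        show "(\<lambda>p. \<ominus>\<^bsub>K\<^esub> \<one>\<^bsub>K\<^esub> \<otimes>\<^bsub>K\<^esub> f p) \<oplus>\<^bsub>?F\<^esub> f = \<zero>\<^bsub>?F\<^esub>"
          using f by (auto simp: free_space_carrier K.l_minus K.l_neg)
      qed
    qed (auto simp: add, (auto simp: free_space_carrier fun_eq_iff K.a_ac)+)
  qed (auto simp: smult assms, (auto simp: free_space_carrier fun_eq_iff K.l_distr K.r_distr K.m_assoc)+)
qed

lemma unit_vector_closed:
  assumes "cring K" and "p \<in> S"
  shows "unit_vector K p \<in> carrier (free_space K S)"
proof -
  interpret K: cring K by fact
  have "{q. unit_vector K p q \<noteq> \<zero>\<^bsub>K\<^esub>} \<subseteq> {p}"
    by (auto simp: unit_vector_def)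
  moreover from this have "finite {q. unit_vector K p q \<noteq> \<zero>\<^bsub>K\<^esub>}"
    by (rule finite_subset) simp
  ultimately show ?thesis
    using assms(2) by (auto simp: free_space_carrier unit_vector_def)
qed

text \<open>A finitely supported function is a finite combination of unit vectors. With
  \<open>H\<close> arbitrary this acts as an induction principle, applied below to equalizers and
  preimages.\<close>

lemma free_space_spanned:
  assumes "cring K" and H: "submodule H K (free_space K S)"
    and unit: "\<And>p. p \<in> S \<Longrightarrow> unit_vector K p \<in> H"
    and f: "f \<in> carrier (free_space K S)"
  shows "f \<in> H"
proof -
  interpret K: cring K by fact
  interpret F: module K "free_space K S" by (rule free_space_module) fact
  note HE = F.submoduleE[OF H]
  \<comment> \<open>The induction runs over a finite superset \<open>A\<close> of the support. An
    inserted point of value zero is harmless; any other value is erased first and restored by a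
    multiple of a unit vector.\<close>
  have "f \<in> H" if "finite A" "{p. f p \<noteq> \<zero>\<^bsub>K\<^esub>} \<subseteq> A" "f \<in> carrier (free_space K S)" for A f
    using that
  proof (induction A arbitrary: f rule: finite_induct)
    case empty
    then have "f = \<zero>\<^bsub>free_space K S\<^esub>" by (auto simp: fun_eq_iff)
    then show ?case using submodule.axioms(1)[OF H] subgroup.one_closed by fastforce
  next
    case (insert p A)
    show ?case
    proof (cases "f p = \<zero>\<^bsub>K\<^esub>")
      case True
      then have "{p. f p \<noteq> \<zero>\<^bsub>K\<^esub>} \<subseteq> A" using insert.prems by auto
      then show ?thesis using insert by blast
    next
      case False
      then have p: "p \<in> S" and fp: "f p \<in> carrier K"
        using insert.prems by (auto simp: free_space_carrier)
      have sub: "{q. (f(p := \<zero>\<^bsub>K\<^esub>)) q \<noteq> \<zero>\<^bsub>K\<^esub>} \<subseteq> {q. f q \<noteq> \<zero>\<^bsub>K\<^esub>}" by auto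
      moreover have "finite {q. f q \<noteq> \<zero>\<^bsub>K\<^esub>}"
        using insert.prems(2) by (simp add: free_space_carrier)
      ultimately have "finite {q. (f(p := \<zero>\<^bsub>K\<^esub>)) q \<noteq> \<zero>\<^bsub>K\<^esub>}"
        by (rule finite_subset)
      then have "f(p := \<zero>\<^bsub>K\<^esub>) \<in> carrier (free_space K S)"
        using insert.prems(2) sub by (auto simp: free_space_carrier)
      then have "f(p := \<zero>\<^bsub>K\<^esub>) \<in> H"
      proof (rule insert.IH[rotated])
        show "{q. (f(p := \<zero>\<^bsub>K\<^esub>)) q \<noteq> \<zero>\<^bsub>K\<^esub>} \<subseteq> A" using insert.prems(1) by auto
      qed
      moreover have "f p \<odot>\<^bsub>free_space K S\<^esub> unit_vector K p \<in> H"
        using HE(4) fp unit[OF p] by blast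
      ultimately have "f(p := \<zero>\<^bsub>K\<^esub>) \<oplus>\<^bsub>free_space K S\<^esub> (f p \<odot>\<^bsub>free_space K S\<^esub> unit_vector K p) \<in> H"
        by (rule HE(5))
      also have "f(p := \<zero>\<^bsub>K\<^esub>) \<oplus>\<^bsub>free_space K S\<^esub> (f p \<odot>\<^bsub>free_space K S\<^esub> unit_vector K p) = f"
        using insert.prems(2) by (auto simp: fun_eq_iff unit_vector_def free_space_carrier)
      finally show ?thesis .
    qed
  qed
  from this[of "{p. f p \<noteq> \<zero>\<^bsub>K\<^esub>}"] f show ?thesis by (auto simp: free_space_carrier)
qed

text \<open>Additivity compares functions with different supports; the extra terms are zero, so all
  sums can be taken over one common index set.\<close>

lemma linear_extension_superset:
  assumes "module K X" and "b \<in> S \<rightarrow> carrier X" and f: "f \<in> carrier (free_space K S)"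
    and A: "finite A" "{p. f p \<noteq> \<zero>\<^bsub>K\<^esub>} \<subseteq> A" "A \<subseteq> S"
  shows "linear_extension K X b f = (\<Oplus>\<^bsub>X\<^esub>p\<in>A. f p \<odot>\<^bsub>X\<^esub> b p)"
proof -
  interpret X: module K X by fact
  show ?thesis
    unfolding linear_extension_def
    using assms by (intro X.add.finprod_mono_neutral_cong_left) (auto simp: free_space_carrier Pi_def)
qed

lemma linear_extension_linear:
  assumes "module K X" and b: "b \<in> S \<rightarrow> carrier X"
  shows "linear_extension K X b \<in> linear_map K (free_space K S) X"
proof -
  interpret X: module K X by fact
  let ?F = "free_space K S"
  interpret F: module K ?F by (rule free_space_module) unfold_locales
  note ext = linear_extension_superset[OF assms]
  show ?thesis
  proof (rule linear_mapI)
    fix f assume f: "f \<in> carrier ?F"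
    show "linear_extension K X b f \<in> carrier X"
      unfolding linear_extension_def
      using f b by (intro X.finsum_closed) (auto simp: free_space_carrier Pi_def)
  next
    fix f g assume f: "f \<in> carrier ?F" and g: "g \<in> carrier ?F"
    let ?A = "{p. f p \<noteq> \<zero>\<^bsub>K\<^esub>} \<union> {p. g p \<noteq> \<zero>\<^bsub>K\<^esub>}"
    have A: "finite ?A" "?A \<subseteq> S" using f g by (auto simp: free_space_carrier)
    have K: "f p \<in> carrier K" "g p \<in> carrier K" for p using f g by (auto simp: free_space_carrier)
    have bA: "b p \<in> carrier X" if "p \<in> ?A" for p using A b that by blast
    have "linear_extension K X b (f \<oplus>\<^bsub>?F\<^esub> g) = (\<Oplus>\<^bsub>X\<^esub>p\<in>?A. (f p \<oplus>\<^bsub>K\<^esub> g p) \<odot>\<^bsub>X\<^esub> b p)"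
    proof (subst ext[OF F.add.m_closed[OF f g] A(1) _ A(2)])
      show "{p. (f \<oplus>\<^bsub>?F\<^esub> g) p \<noteq> \<zero>\<^bsub>K\<^esub>} \<subseteq> ?A" using K by auto
    qed simp
    also have "\<dots> = (\<Oplus>\<^bsub>X\<^esub>p\<in>?A. f p \<odot>\<^bsub>X\<^esub> b p \<oplus>\<^bsub>X\<^esub> g p \<odot>\<^bsub>X\<^esub> b p)"
      using K bA by (intro X.finsum_cong') (auto simp: X.smult_l_distr)
    also have "\<dots> = (\<Oplus>\<^bsub>X\<^esub>p\<in>?A. f p \<odot>\<^bsub>X\<^esub> b p) \<oplus>\<^bsub>X\<^esub> (\<Oplus>\<^bsub>X\<^esub>p\<in>?A. g p \<odot>\<^bsub>X\<^esub> b p)"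
      using K bA by (intro X.finsum_addf) auto
    finally show "linear_extension K X b (f \<oplus>\<^bsub>?F\<^esub> g) =
        linear_extension K X b f \<oplus>\<^bsub>X\<^esub> linear_extension K X b g"
      using ext[OF f A(1) _ A(2)] ext[OF g A(1) _ A(2)] by simp
  next
    fix a f assume a: "a \<in> carrier K" and f: "f \<in> carrier ?F"
    let ?A = "{p. f p \<noteq> \<zero>\<^bsub>K\<^esub>}"
    have A: "finite ?A" "?A \<subseteq> S" using f by (auto simp: free_space_carrier)
    have K: "f p \<in> carrier K" for p using f by (auto simp: free_space_carrier)
    have bA: "b p \<in> carrier X" if "p \<in> ?A" for p using A b that by blast
    have "{p. a \<otimes>\<^bsub>K\<^esub> f p \<noteq> \<zero>\<^bsub>K\<^esub>} \<subseteq> ?A" using a by auto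
    then have "linear_extension K X b (a \<odot>\<^bsub>?F\<^esub> f) = (\<Oplus>\<^bsub>X\<^esub>p\<in>?A. (a \<otimes>\<^bsub>K\<^esub> f p) \<odot>\<^bsub>X\<^esub> b p)"
      using ext[OF F.smult_closed[OF a f] A(1) _ A(2)] by auto
    also have "\<dots> = (\<Oplus>\<^bsub>X\<^esub>p\<in>?A. a \<odot>\<^bsub>X\<^esub> (f p \<odot>\<^bsub>X\<^esub> b p))"
      using K bA a by (intro X.finsum_cong') (auto simp: X.smult_assoc1)
    also have "\<dots> = a \<odot>\<^bsub>X\<^esub> linear_extension K X b f"
      unfolding linear_extension_def
      using A K bA a by (intro X.finsum_smult_ldistr[symmetric]) auto
    finally show "linear_extension K X b (a \<odot>\<^bsub>?F\<^esub> f) = a \<odot>\<^bsub>X\<^esub> linear_extension K X b f" .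
  qed
qed

lemma linear_extension_unit_vector:
  assumes "module K X" and "b \<in> S \<rightarrow> carrier X" and "p \<in> S"
  shows "linear_extension K X b (unit_vector K p) = b p"
proof -
  interpret X: module K X by fact
  have bp: "b p \<in> carrier X" using assms by blast
  \<comment> \<open>Summing over \<open>{p}\<close> instead of the support avoids asking whether one
    and zero differ in \<open>K\<close>.\<close>
  have "linear_extension K X b (unit_vector K p) = (\<Oplus>\<^bsub>X\<^esub>q\<in>{p}. unit_vector K p q \<odot>\<^bsub>X\<^esub> b q)"
    using assms unit_vector_closed[OF X.R.is_cring assms(3)]
    by (intro linear_extension_superset[of K X b S]) (auto simp: unit_vector_def)
  also have "\<dots> = b p"
    using bp X.finsum_insert[of "{}" p] by (simp add: unit_vector_def)
  finally show ?thesis .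
qed


section \<open>Lifting bilinear maps to the tensor product\<close>

text \<open>
  The last five conjuncts are the relations (i)--(v) of the tensor product with \<open>m \<star> n\<close> replaced by
  \<open>b m n\<close>.
\<close>

definition star_compatible ::
    "('k, 'r) ring_scheme \<Rightarrow> ('k, 'a) hom_lie \<Rightarrow> ('k, 'x, 'm) module_scheme \<Rightarrow> ('a \<Rightarrow> 'a \<Rightarrow> 'x) \<Rightarrow> bool"
  where
  "star_compatible K L X b \<longleftrightarrow> (let C = carrier L; B = bracket L; \<alpha> = twist L in
     (\<forall>n\<in>C. (\<lambda>m. b m n) \<in> linear_map K L X) \<and>
     (\<forall>m\<in>C. b m \<in> linear_map K L X) \<and>
     (\<forall>m\<in>C. \<forall>m'\<in>C. \<forall>n\<in>C.
        b (B m m') (\<alpha> n) \<ominus>\<^bsub>X\<^esub> b (\<alpha> m) (B m' n) \<oplus>\<^bsub>X\<^esub> b (\<alpha> m') (B m n) = \<zero>\<^bsub>X\<^esub>) \<and>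
     (\<forall>m\<in>C. \<forall>n\<in>C. \<forall>n'\<in>C.
        b (\<alpha> m) (B n n') \<ominus>\<^bsub>X\<^esub> b (B n' m) (\<alpha> n) \<oplus>\<^bsub>X\<^esub> b (B n m) (\<alpha> n') = \<zero>\<^bsub>X\<^esub>) \<and>
     (\<forall>m\<in>C. \<forall>n\<in>C. b (B n m) (B m n) = \<zero>\<^bsub>X\<^esub>) \<and>
     (\<forall>m\<in>C. \<forall>n\<in>C. \<forall>m'\<in>C. \<forall>n'\<in>C.
        b (B n m) (B m' n') \<oplus>\<^bsub>X\<^esub> b (B n' m') (B m n) = \<zero>\<^bsub>X\<^esub>) \<and>
     (\<forall>m\<in>C. \<forall>n\<in>C. \<forall>m'\<in>C. \<forall>n'\<in>C. \<forall>m''\<in>C. \<forall>n''\<in>C.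
        b (B (B n m) (B n' m')) (\<alpha> (B m'' n'')) \<oplus>\<^bsub>X\<^esub>
        b (B (B n' m') (B n'' m'')) (\<alpha> (B m n)) \<oplus>\<^bsub>X\<^esub>
        b (B (B n'' m'') (B n m)) (\<alpha> (B m' n')) = \<zero>\<^bsub>X\<^esub>))"

lemma star_compatibleD:
  assumes "star_compatible K L X b"
  shows "n \<in> carrier L \<Longrightarrow> (\<lambda>m. b m n) \<in> linear_map K L X"
    and "m \<in> carrier L \<Longrightarrow> b m \<in> linear_map K L X"
    and "\<lbrakk>m \<in> carrier L; n \<in> carrier L; n' \<in> carrier L\<rbrakk> \<Longrightarrow>
      b (twist L m) \<lbrakk>n, n'\<rbrakk>\<^bsub>L\<^esub> \<ominus>\<^bsub>X\<^esub> b \<lbrakk>n', m\<rbrakk>\<^bsub>L\<^esub> (twist L n) \<oplus>\<^bsub>X\<^esub> b \<lbrakk>n, m\<rbrakk>\<^bsub>L\<^esub> (twist L n') = \<zero>\<^bsub>X\<^esub>"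
    and "\<lbrakk>m \<in> carrier L; n \<in> carrier L; m' \<in> carrier L; n' \<in> carrier L\<rbrakk> \<Longrightarrow>
      b \<lbrakk>n, m\<rbrakk>\<^bsub>L\<^esub> \<lbrakk>m', n'\<rbrakk>\<^bsub>L\<^esub> \<oplus>\<^bsub>X\<^esub> b \<lbrakk>n', m'\<rbrakk>\<^bsub>L\<^esub> \<lbrakk>m, n\<rbrakk>\<^bsub>L\<^esub> = \<zero>\<^bsub>X\<^esub>"
  using assms by (simp_all add: star_compatible_def Let_def)

lemma star_compatible_closed:
  "\<lbrakk>star_compatible K L X b; m \<in> carrier L; n \<in> carrier L\<rbrakk> \<Longrightarrow> b m n \<in> carrier X"
  by (rule linear_map_closed[OF star_compatibleD(2)])

section \<open>Homomorphisms and the transport of compatible maps\<close>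

lemma hom_lie_homD:
  assumes "f \<in> hom_lie_hom K L L'"
  shows "f \<in> linear_map K L L'"
    and "x \<in> carrier L \<Longrightarrow> f x \<in> carrier L'"
    and "\<lbrakk>x \<in> carrier L; y \<in> carrier L\<rbrakk> \<Longrightarrow> f \<lbrakk>x, y\<rbrakk>\<^bsub>L\<^esub> = \<lbrakk>f x, f y\<rbrakk>\<^bsub>L'\<^esub>"
    and "x \<in> carrier L \<Longrightarrow> f (twist L x) = twist L' (f x)"
  using assms by (auto simp: hom_lie_hom_def linear_map_def)

lemma hom_lie_homI:
  assumes "f \<in> linear_map K L L'"
    and "\<And>x y. \<lbrakk>x \<in> carrier L; y \<in> carrier L\<rbrakk> \<Longrightarrow> f \<lbrakk>x, y\<rbrakk>\<^bsub>L\<^esub> = \<lbrakk>f x, f y\<rbrakk>\<^bsub>L'\<^esub>"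
    and "\<And>x. x \<in> carrier L \<Longrightarrow> f (twist L x) = twist L' (f x)"
  shows "f \<in> hom_lie_hom K L L'"
  using assms by (auto simp: hom_lie_hom_def linear_map_def)

lemma hom_lie_hom_compose:
  assumes "f \<in> hom_lie_hom K L L'" and "g \<in> hom_lie_hom K L' L''"
  shows "(\<lambda>x. g (f x)) \<in> hom_lie_hom K L L''"
  using assms by (auto simp: hom_lie_hom_def Pi_def)

text \<open>The conditions involve only operations that \<phi> preserves, so each is an instance of
  the condition for \<open>b\<close> at images under \<phi>.\<close>

lemma star_compatible_pullback:
  assumes L: "hom_lie_algebra K L" and \<phi>: "\<phi> \<in> hom_lie_hom K L L'" and b: "star_compatible K L' X b"
  shows "star_compatible K L X (\<lambda>m n. b (\<phi> m) (\<phi> n))"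
proof -
  interpret L: hom_lie_algebra K L by fact
  note h = hom_lie_homD[OF \<phi>]
  have "(\<lambda>m. b (\<phi> m) (\<phi> n)) \<in> linear_map K L X" if "n \<in> carrier L" for n
    using linear_map_compose[OF h(1) star_compatibleD(1)[OF b]] h(2) that by blast
  moreover have "(\<lambda>n. b (\<phi> m) (\<phi> n)) \<in> linear_map K L X" if "m \<in> carrier L" for m
    using linear_map_compose[OF h(1) star_compatibleD(2)[OF b]] h(2) that by blast
  ultimately show ?thesis
    using b unfolding star_compatible_def Let_def
    by (simp add: h L.bracket_closed L.twist_closed)
qed

text \<open>Since \<pi> is onto, every condition on \<open>b\<close> is the image of one on
  \<open>b'\<close>; nothing about \<open>b\<close> itself, not even linearity, has to be known
  beforehand. This is how the bracket of a central extension descends to its base.\<close>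

lemma star_compatible_pushforward:
  assumes L: "hom_lie_algebra K L" and \<pi>: "\<pi> \<in> hom_lie_hom K L L'"
    and surj: "\<pi> ` carrier L = carrier L'"
    and b': "star_compatible K L X b'"
    and eq: "\<And>m n. \<lbrakk>m \<in> carrier L; n \<in> carrier L\<rbrakk> \<Longrightarrow> b (\<pi> m) (\<pi> n) = b' m n"
  shows "star_compatible K L' X b"
proof -
  interpret L: hom_lie_algebra K L by fact
  note h = hom_lie_homD[OF \<pi>]
  note hs = h(3,4)[symmetric] linear_map_add[OF h(1), symmetric] linear_map_smult[OF h(1), symmetric]
  \<comment> \<open>Rewriting \<open>carrier L'\<close> as the image of \<pi> presents each of its
    elements as some \<open>\<pi> m\<close>, where \<open>eq\<close> applies.\<close>
  have "(\<lambda>m. b m (\<pi> n)) \<in> linear_map K L' X" if "n \<in> carrier L" for n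
    using star_compatibleD(1)[OF b' that]
    by (intro linear_mapI; unfold surj[symmetric])
      (auto simp: hs eq that linear_map_def)
  moreover have "b (\<pi> m) \<in> linear_map K L' X" if "m \<in> carrier L" for m
    using star_compatibleD(2)[OF b' that]
    by (intro linear_mapI; unfold surj[symmetric])
      (auto simp: hs eq that linear_map_def)
  ultimately show ?thesis
    using b' unfolding star_compatible_def Let_def surj[symmetric]
    by (simp add: hs eq L.bracket_closed L.twist_closed)
qed

definition star_relations :: "('k, 'r) ring_scheme \<Rightarrow> ('k, 'a) hom_lie \<Rightarrow> ('a \<times> 'a \<Rightarrow> 'k) set" where
  "star_relations K L =
     bilinear_relations K L (carrier L) (carrier L) \<union> hom_lie_relations K L (carrier L) (carrier L)"

lemma point_eq: "point K m n = unit_vector K (m, n)"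
  by (simp add: point_def unit_vector_def)

text \<open>The families of relations have two, three, four or six parameters; these rules turn a
  bound over such a family into quantifiers over its parameters.\<close>

lemma ball_image_Collect:
  "(\<forall>r\<in>{f a b |a b. P2 a b}. S r) \<longleftrightarrow> (\<forall>a b. P2 a b \<longrightarrow> S (f a b))"
  "(\<forall>r\<in>{f3 a b c |a b c. P3 a b c}. S r) \<longleftrightarrow> (\<forall>a b c. P3 a b c \<longrightarrow> S (f3 a b c))"
  "(\<forall>r\<in>{f4 a b c d |a b c d. P4 a b c d}. S r) \<longleftrightarrow> (\<forall>a b c d. P4 a b c d \<longrightarrow> S (f4 a b c d))"
  "(\<forall>r\<in>{f6 a b c d e f |a b c d e f. P6 a b c d e f}. S r) \<longleftrightarrow>
     (\<forall>a b c d e f. P6 a b c d e f \<longrightarrow> S (f6 a b c d e f))"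
  by blast+

lemma (in abelian_group) minus_eq_iff:
  assumes "x \<in> carrier G" "y \<in> carrier G" "z \<in> carrier G"
  shows "x \<ominus> y = z \<longleftrightarrow> x = y \<oplus> z"
  using assms add.inv_solve_right[of z x y] by (auto simp: a_minus_def a_comm)

section \<open>The tensor square as a quotient and its universal property\<close>

context hom_lie_algebra
begin

abbreviation F where "F \<equiv> free_space K (carrier L \<times> carrier L)"
abbreviation R where "R \<equiv> star_null K L (carrier L) (carrier L)"
abbreviation Q where "Q \<equiv> star_space K L (carrier L) (carrier L)"
abbreviation T where "T \<equiv> star_square K L"
abbreviation s where "s \<equiv> star_elt K L (carrier L) (carrier L)"

lemma F_module: "module K F"
  by (rule free_space_module) unfold_locales

lemma point_closed: "\<lbrakk>m \<in> carrier L; n \<in> carrier L\<rbrakk> \<Longrightarrow> point K m n \<in> carrier F"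
  unfolding point_eq by (rule unit_vector_closed) (unfold_locales, simp)

lemma star_relations_closed: "star_relations K L \<subseteq> carrier F"
proof -
  interpret F: module K F by (rule F_module)
  show ?thesis
    unfolding star_relations_def bilinear_relations_def hom_lie_relations_def Let_def
    by (safe; intro F.minus_closed F.add.m_closed F.smult_closed point_closed
        bracket_closed twist_closed M.add.m_closed smult_closed)
qed

text \<open>The bridge between generators of the null space and conditions on a bilinear map. Read
  from left to right for the class map it makes \<open>s\<close> compatible; read from right to left
  it makes lifts well defined.\<close>

lemma star_relations_vanish_iff:
  assumes X: "module K X" and h: "h \<in> linear_map K F X"
  shows "(\<forall>r\<in>star_relations K L. h r = \<zero>\<^bsub>X\<^esub>) \<longleftrightarrow> star_compatible K L X (\<lambda>m n. h (point K m n))"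
proof -
  interpret F: module K F by (rule F_module)
  interpret X: module K X by fact
  note hs = linear_map_minus[OF F_module X h] linear_map_add[OF h] linear_map_smult[OF h]
    linear_map_closed[OF h] point_closed bracket_closed twist_closed
  \<comment> \<open>The bilinear families regroup into linearity in each argument; the families
    (i)--(v) match the remaining conjuncts one by one.\<close>
  have "(\<forall>r\<in>bilinear_relations K L (carrier L) (carrier L). h r = \<zero>\<^bsub>X\<^esub>) \<longleftrightarrow>
      (\<forall>n\<in>carrier L. (\<lambda>m. h (point K m n)) \<in> linear_map K L X) \<and>
      (\<forall>m\<in>carrier L. (\<lambda>n. h (point K m n)) \<in> linear_map K L X)"
    unfolding bilinear_relations_def Let_def ball_Un ball_image_Collect
    by (simp add: linear_map_def Pi_def hs X.minus_eq_iff
        cong: conj_cong del: free_space_ops) (safe; simp)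
  then show ?thesis
    unfolding star_relations_def ball_Un star_compatible_def hom_lie_relations_def Let_def
      ball_image_Collect
    by (simp add: hs Ball_def imp_conjL del: free_space_ops)
qed

lemma R_submodule: "submodule R K F"
  unfolding star_null_def
  using submodule_hull[OF F_module star_relations_closed] unfolding star_relations_def .

lemma star_relations_subset: "star_relations K L \<subseteq> R"
  unfolding star_null_def star_relations_def by (rule hull_subset)

lemma Q_eq: "Q = quotient_space F R"
  by (simp add: star_space_def quotient_space_def Let_def)

lemma Q_module: "module K Q"
  unfolding Q_eq by (rule quotient_space_module[OF F_module R_submodule])

lemma class_linear: "(\<lambda>f. R +>\<^bsub>F\<^esub> f) \<in> linear_map K F Q"
  unfolding Q_eq by (rule quotient_map_linear[OF F_module R_submodule])

lemma Q_carrier: "carrier Q = (\<lambda>f. R +>\<^bsub>F\<^esub> f) ` carrier F"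
  unfolding Q_eq by (rule quotient_space_carrier[OF F_module R_submodule])

lemma class_null: "r \<in> R \<Longrightarrow> R +>\<^bsub>F\<^esub> r = \<zero>\<^bsub>Q\<^esub>"
  unfolding Q_eq by (rule quotient_map_null[OF F_module R_submodule])

lemma star_elt_compatible_space: "star_compatible K L Q s"
proof -
  have "\<forall>r\<in>star_relations K L. R +>\<^bsub>F\<^esub> r = \<zero>\<^bsub>Q\<^esub>"
    using class_null star_relations_subset by blast
  then show ?thesis
    using star_relations_vanish_iff[OF Q_module class_linear] by (simp add: star_elt_def[abs_def])
qed

text \<open>Two members of a coset differ by an element of \<open>R\<close>, where the extension
  vanishes. Its image of the coset is thus a singleton, which justifies
  \<open>the_elem\<close>.\<close>

lemma star_lift_class:
  assumes X: "module K X"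
    and b: "\<And>m n. \<lbrakk>m \<in> carrier L; n \<in> carrier L\<rbrakk> \<Longrightarrow> b m n \<in> carrier X"
    and null: "\<And>r. r \<in> R \<Longrightarrow> linear_extension K X (case_prod b) r = \<zero>\<^bsub>X\<^esub>"
    and f: "f \<in> carrier F"
  shows "star_lift K X b (R +>\<^bsub>F\<^esub> f) = linear_extension K X (case_prod b) f"
proof -
  interpret F: module K F by (rule F_module)
  interpret X: module K X by fact
  interpret R: submodule R K F by (rule R_submodule)
  let ?E = "linear_extension K X (case_prod b)"
  have E: "?E \<in> linear_map K F X"
    using b by (intro linear_extension_linear X) auto
  have RF: "R \<subseteq> carrier F" using F.submoduleE(1)[OF R_submodule] .
  have "?E g = ?E f" if "g \<in> R +>\<^bsub>F\<^esub> f" for g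
  proof -
    obtain r where r: "r \<in> R" "g = r \<oplus>\<^bsub>F\<^esub> f"
      using \<open>g \<in> R +>\<^bsub>F\<^esub> f\<close> by (auto simp: a_r_coset_def')
    then show ?thesis
      using RF f linear_map_add[OF E, of r f] null linear_map_closed[OF E f] by auto
  qed
  moreover have "f \<in> R +>\<^bsub>F\<^esub> f"
    using F.a_rcosI[of "\<zero>\<^bsub>F\<^esub>" R f] RF f R.one_closed F.l_zero[OF f]
    by (simp del: free_space_ops)
  ultimately have "?E ` (R +>\<^bsub>F\<^esub> f) = {?E f}" by blast
  then show ?thesis
    by (simp add: star_lift_def linear_extension_def[abs_def] case_prod_unfold)
qed

lemma linear_extension_point:
  assumes X: "module K X"
    and b: "\<And>m n. \<lbrakk>m \<in> carrier L; n \<in> carrier L\<rbrakk> \<Longrightarrow> b m n \<in> carrier X"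
    and "m \<in> carrier L" "n \<in> carrier L"
  shows "linear_extension K X (case_prod b) (point K m n) = b m n"
  using linear_extension_unit_vector[OF X, of "case_prod b" "carrier L \<times> carrier L" "(m, n)"] assms
  by (simp add: point_eq Pi_def)

text \<open>No relation has to be checked for \<open>b\<close>: a linear \<open>h\<close> on the
  quotient with the right values on generators already forces the extension of \<open>b\<close> to
  vanish on \<open>R\<close>. The nested lifts in the bracket are evaluated this way.\<close>

lemma star_lift_unique:
  assumes X: "module K X" and h: "h \<in> linear_map K Q X"
    and b: "\<And>m n. \<lbrakk>m \<in> carrier L; n \<in> carrier L\<rbrakk> \<Longrightarrow> b m n = h (s m n)"
    and c: "c \<in> carrier Q"
  shows "star_lift K X b c = h c"
proof -
  let ?E = "linear_extension K X (case_prod b)" and ?h = "\<lambda>f. h (R +>\<^bsub>F\<^esub> f)"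
  have b_closed: "b m n \<in> carrier X" if "m \<in> carrier L" "n \<in> carrier L" for m n
    using b that star_compatible_closed[OF star_elt_compatible_space] linear_map_closed[OF h] by simp
  have h': "?h \<in> linear_map K F X"
    by (rule linear_map_compose[OF class_linear h])
  have E: "?E \<in> linear_map K F X"
    using b_closed by (intro linear_extension_linear X) auto
  have eq: "?E f = ?h f" if "f \<in> carrier F" for f
  proof -
    have "f \<in> {f \<in> carrier F. ?E f = ?h f}"
    proof (rule free_space_spanned[OF is_cring submodule_equalizer[OF F_module X E h'] _ that])
      fix p assume "p \<in> carrier L \<times> carrier L"
      then obtain m n where p: "p = (m, n)" "m \<in> carrier L" "n \<in> carrier L" by auto
      then show "unit_vector K p \<in> {f \<in> carrier F. ?E f = ?h f}"
        using linear_extension_point[OF X b_closed p(2,3)] b point_closed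
        by (simp add: point_eq[symmetric] star_elt_def)
    qed
    then show ?thesis by simp
  qed
  have "?E r = \<zero>\<^bsub>X\<^esub>" if "r \<in> R" for r
  proof -
    have "r \<in> carrier F" using module.submoduleE(1)[OF F_module R_submodule] that by blast
    then show ?thesis
      using eq class_null[OF that] linear_map_zero[OF Q_module X h] by simp
  qed
  then show ?thesis
    using c eq star_lift_class[OF X b_closed] by (auto simp: Q_carrier)
qed

text \<open>Existence, complementing \<open>star_lift_unique\<close>: the kernel of the extension of
  \<open>b\<close> is a submodule containing all relations, hence contains \<open>R\<close>.\<close>

lemma
  assumes X: "module K X" and b: "star_compatible K L X b"
  shows star_lift_linear_space: "star_lift K X b \<in> linear_map K Q X"
    and star_lift_elt: "\<lbrakk>m \<in> carrier L; n \<in> carrier L\<rbrakk> \<Longrightarrow> star_lift K X b (s m n) = b m n"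
proof -
  interpret F: module K F by (rule F_module)
  interpret Q: module K Q by (rule Q_module)
  let ?E = "linear_extension K X (case_prod b)"
  note closed = star_compatible_closed[OF b]
  note point = linear_extension_point[OF X closed]
  have E: "?E \<in> linear_map K F X"
    using closed by (intro linear_extension_linear X) auto
  have id: "(\<lambda>x. x) \<in> hom_lie_hom K L L"
    by (auto simp: hom_lie_hom_def)
  \<comment> \<open>The two maps agree only on the carrier; pushing forward along the identity
    replaces one by the other.\<close>
  have "star_compatible K L X (\<lambda>m n. ?E (point K m n))"
    by (rule star_compatible_pushforward[OF hom_lie_algebra_axioms id _ b]) (auto simp: point)
  then have "star_relations K L \<subseteq> {f \<in> carrier F. ?E f = \<zero>\<^bsub>X\<^esub>}"
    using star_relations_closed star_relations_vanish_iff[OF X E] by auto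
  then have "R \<subseteq> {f \<in> carrier F. ?E f = \<zero>\<^bsub>X\<^esub>}"
    unfolding star_null_def star_relations_def
    by (rule hull_minimal) (rule submodule_equalizer[OF F_module X E linear_map_const_zero[OF X]])
  then have lift: "star_lift K X b (R +>\<^bsub>F\<^esub> f) = ?E f" if "f \<in> carrier F" for f
    using that by (intro star_lift_class[OF X closed]) auto
  show "star_lift K X b \<in> linear_map K Q X"
    by (rule linear_mapI; unfold Q_carrier)
      (auto simp: lift linear_map_closed[OF E] linear_map_add[OF E] linear_map_smult[OF E]
        linear_map_add[OF class_linear, symmetric] linear_map_smult[OF class_linear, symmetric]
        simp del: free_space_ops)
  show "star_lift K X b (s m n) = b m n" if "m \<in> carrier L" "n \<in> carrier L"
    using that by (simp add: star_elt_def lift point_closed point)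
qed

end


section \<open>The tensor square of a perfect Hom-Lie algebra\<close>

context hom_lie_algebra
begin

text \<open>\<open>T\<close> adds a bracket and a twist to the vector space \<open>Q\<close>. Later
  proofs often delete these rules so that goals keep matching facts stated for
  \<open>T\<close>.\<close>

lemma T_simps [simp]:
  "carrier T = carrier Q" "zero T = zero Q" "add T = add Q" "smult T = smult Q"
  by (simp_all add: star_square_def star_def Let_def)

lemma T_module: "module K T"
  by (rule module_cong[OF Q_module]) simp_all

lemma linear_map_T: "linear_map K T X = linear_map K Q X" "linear_map K X T = linear_map K X Q"
  by (simp_all add: linear_map_def)

lemma star_elt_compatible: "star_compatible K L T s"
proof -
  have "(\<lambda>f. R +>\<^bsub>F\<^esub> f) \<in> linear_map K F T"
    using class_linear by (simp add: linear_map_T)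
  moreover have "\<forall>r\<in>star_relations K L. R +>\<^bsub>F\<^esub> r = \<zero>\<^bsub>T\<^esub>"
    using class_null star_relations_subset by auto
  ultimately show ?thesis
    using star_relations_vanish_iff[OF T_module] by (simp add: star_elt_def[abs_def])
qed

lemmas star_elt_closed = star_compatible_closed[OF star_elt_compatible]
  and star_elt_linear = star_compatibleD(1,2)[OF star_elt_compatible]

lemmas star_lift_linear = star_lift_linear_space[folded linear_map_T(1)]

text \<open>Both maps are the lift of their common values on generators.\<close>

lemma T_linear_eqI:
  assumes X: "module K X" and h: "h \<in> linear_map K T X" "g \<in> linear_map K T X"
    and eq: "\<And>m n. \<lbrakk>m \<in> carrier L; n \<in> carrier L\<rbrakk> \<Longrightarrow> h (s m n) = g (s m n)"
    and c: "c \<in> carrier T"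
  shows "h c = g c"
proof -
  have "h c = star_lift K X (\<lambda>m n. h (s m n)) c"
    using star_lift_unique[OF X h(1)[unfolded linear_map_T]] c by simp
  also have "\<dots> = g c"
    using star_lift_unique[OF X h(2)[unfolded linear_map_T]] c eq by simp
  finally show ?thesis .
qed

text \<open>The preimage of \<open>H\<close> under the class map contains the unit vectors, so it is
  the whole free space.\<close>

lemma T_spanned:
  assumes H: "submodule H K T" and s: "\<And>m n. \<lbrakk>m \<in> carrier L; n \<in> carrier L\<rbrakk> \<Longrightarrow> s m n \<in> H"
  shows "carrier T \<subseteq> H"
proof -
  have lin: "(\<lambda>f. R +>\<^bsub>F\<^esub> f) \<in> linear_map K F T"
    using class_linear by (simp add: linear_map_T)
  have "f \<in> {f \<in> carrier F. R +>\<^bsub>F\<^esub> f \<in> H}" if "f \<in> carrier F" for f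
  proof (rule free_space_spanned[OF is_cring submodule_vimage[OF F_module T_module lin H] _ that])
    fix p assume "p \<in> carrier L \<times> carrier L"
    then show "unit_vector K p \<in> {f \<in> carrier F. R +>\<^bsub>F\<^esub> f \<in> H}"
      using s point_closed by (auto simp: point_eq[symmetric] star_elt_def)
  qed
  then show ?thesis by (auto simp: Q_carrier)
qed

section \<open>The bracket and the twist as compatible maps\<close>

lemma bracket_linear:
  shows "y \<in> carrier L \<Longrightarrow> (\<lambda>x. \<lbrakk>x, y\<rbrakk>\<^bsub>L\<^esub>) \<in> linear_map K L L"
    and "x \<in> carrier L \<Longrightarrow> bracket L x \<in> linear_map K L L"
  by (auto intro!: linear_mapI simp: bracket_closed bracket_add_left bracket_add_right
      bracket_smult_left bracket_smult_right)

lemma L_module: "module K L" ..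

lemma bracket_uminus:
  assumes "x \<in> carrier L" "y \<in> carrier L"
  shows "\<lbrakk>\<ominus>\<^bsub>L\<^esub> x, y\<rbrakk>\<^bsub>L\<^esub> = \<ominus>\<^bsub>L\<^esub> \<lbrakk>x, y\<rbrakk>\<^bsub>L\<^esub>" and "\<lbrakk>x, \<ominus>\<^bsub>L\<^esub> y\<rbrakk>\<^bsub>L\<^esub> = \<ominus>\<^bsub>L\<^esub> \<lbrakk>x, y\<rbrakk>\<^bsub>L\<^esub>"
  using assms linear_map_uminus[OF L_module L_module bracket_linear(1)]
    linear_map_uminus[OF L_module L_module bracket_linear(2)] by simp_all

lemma twist_hom: "twist L \<in> hom_lie_hom K L L"
  by (auto simp: hom_lie_hom_def twist_closed twist_add twist_smult twist_bracket)

text \<open>Skew-symmetry gives only that twice \<open>[x, x]\<close> is zero; the characteristic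
  enters by making two a unit.\<close>

lemma bracket_alternating:
  assumes two: "\<one>\<^bsub>K\<^esub> \<oplus>\<^bsub>K\<^esub> \<one>\<^bsub>K\<^esub> \<noteq> \<zero>\<^bsub>K\<^esub>" and x: "x \<in> carrier L"
  shows "\<lbrakk>x, x\<rbrakk>\<^bsub>L\<^esub> = \<zero>\<^bsub>L\<^esub>"
proof -
  let ?z = "\<lbrakk>x, x\<rbrakk>\<^bsub>L\<^esub>" and ?t = "\<one>\<^bsub>K\<^esub> \<oplus>\<^bsub>K\<^esub> \<one>\<^bsub>K\<^esub>"
  have z: "?z \<in> carrier L" using x by (simp add: bracket_closed)
  have t: "?t \<in> Units K" using two field_Units by auto
  have "?t \<odot>\<^bsub>L\<^esub> ?z = ?z \<oplus>\<^bsub>L\<^esub> ?z"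
    using z by (simp add: smult_l_distr)
  also have "\<dots> = ?z \<oplus>\<^bsub>L\<^esub> \<ominus>\<^bsub>L\<^esub> ?z"
    using bracket_skew[OF x x] by simp
  finally have "?t \<odot>\<^bsub>L\<^esub> ?z = \<zero>\<^bsub>L\<^esub>"
    using z by (simp add: M.r_neg)
  then have "inv\<^bsub>K\<^esub> ?t \<odot>\<^bsub>L\<^esub> (?t \<odot>\<^bsub>L\<^esub> ?z) = \<zero>\<^bsub>L\<^esub>"
    using t by simp
  then show ?thesis
    using z t smult_assoc1[of "inv\<^bsub>K\<^esub> ?t" ?t ?z] by (simp add: Units_l_inv)
qed

text \<open>Up to skew-symmetry, (i), (ii) and (v) are instances of the Hom-Jacobi identity and (iv)
  is skew-symmetry itself. Relation (iii) needs the bracket to be alternating, hence the hypothesis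
  on \<open>K\<close>.\<close>

lemma bracket_compatible:
  assumes two: "\<one>\<^bsub>K\<^esub> \<oplus>\<^bsub>K\<^esub> \<one>\<^bsub>K\<^esub> \<noteq> \<zero>\<^bsub>K\<^esub>"
  shows "star_compatible K L L (bracket L)"
proof -
  note closed = bracket_closed twist_closed
  note bu = bracket_uminus closed
  have rel1: "\<lbrakk>\<lbrakk>m, m'\<rbrakk>\<^bsub>L\<^esub>, twist L n\<rbrakk>\<^bsub>L\<^esub> \<ominus>\<^bsub>L\<^esub> \<lbrakk>twist L m, \<lbrakk>m', n\<rbrakk>\<^bsub>L\<^esub>\<rbrakk>\<^bsub>L\<^esub> \<oplus>\<^bsub>L\<^esub>
      \<lbrakk>twist L m', \<lbrakk>m, n\<rbrakk>\<^bsub>L\<^esub>\<rbrakk>\<^bsub>L\<^esub> = \<zero>\<^bsub>L\<^esub>"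
    if mn: "m \<in> carrier L" "m' \<in> carrier L" "n \<in> carrier L" for m m' n
  proof -
    have "\<lbrakk>\<lbrakk>m, m'\<rbrakk>\<^bsub>L\<^esub>, twist L n\<rbrakk>\<^bsub>L\<^esub> = \<ominus>\<^bsub>L\<^esub> \<lbrakk>twist L n, \<lbrakk>m, m'\<rbrakk>\<^bsub>L\<^esub>\<rbrakk>\<^bsub>L\<^esub>"
      using mn by (intro bracket_skew closed)
    moreover have "\<lbrakk>twist L m', \<lbrakk>m, n\<rbrakk>\<^bsub>L\<^esub>\<rbrakk>\<^bsub>L\<^esub> = \<ominus>\<^bsub>L\<^esub> \<lbrakk>twist L m', \<lbrakk>n, m\<rbrakk>\<^bsub>L\<^esub>\<rbrakk>\<^bsub>L\<^esub>"
      using mn bracket_skew[of m n] by (simp add: bu)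
    ultimately have "\<lbrakk>\<lbrakk>m, m'\<rbrakk>\<^bsub>L\<^esub>, twist L n\<rbrakk>\<^bsub>L\<^esub> \<ominus>\<^bsub>L\<^esub> \<lbrakk>twist L m, \<lbrakk>m', n\<rbrakk>\<^bsub>L\<^esub>\<rbrakk>\<^bsub>L\<^esub> \<oplus>\<^bsub>L\<^esub>
        \<lbrakk>twist L m', \<lbrakk>m, n\<rbrakk>\<^bsub>L\<^esub>\<rbrakk>\<^bsub>L\<^esub> = \<ominus>\<^bsub>L\<^esub> (\<lbrakk>twist L m, \<lbrakk>m', n\<rbrakk>\<^bsub>L\<^esub>\<rbrakk>\<^bsub>L\<^esub> \<oplus>\<^bsub>L\<^esub>
        \<lbrakk>twist L n, \<lbrakk>m, m'\<rbrakk>\<^bsub>L\<^esub>\<rbrakk>\<^bsub>L\<^esub> \<oplus>\<^bsub>L\<^esub> \<lbrakk>twist L m', \<lbrakk>n, m\<rbrakk>\<^bsub>L\<^esub>\<rbrakk>\<^bsub>L\<^esub>)"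
      using mn by (simp add: closed a_minus_def M.minus_add M.a_ac)
    then show ?thesis using hom_jacobi[of m m' n] mn by simp
  qed
  have rel2: "\<lbrakk>twist L m, \<lbrakk>n, n'\<rbrakk>\<^bsub>L\<^esub>\<rbrakk>\<^bsub>L\<^esub> \<ominus>\<^bsub>L\<^esub> \<lbrakk>\<lbrakk>n', m\<rbrakk>\<^bsub>L\<^esub>, twist L n\<rbrakk>\<^bsub>L\<^esub> \<oplus>\<^bsub>L\<^esub>
      \<lbrakk>\<lbrakk>n, m\<rbrakk>\<^bsub>L\<^esub>, twist L n'\<rbrakk>\<^bsub>L\<^esub> = \<zero>\<^bsub>L\<^esub>"
    if mn: "m \<in> carrier L" "n \<in> carrier L" "n' \<in> carrier L" for m n n'
  proof -
    have "\<lbrakk>\<lbrakk>n', m\<rbrakk>\<^bsub>L\<^esub>, twist L n\<rbrakk>\<^bsub>L\<^esub> = \<ominus>\<^bsub>L\<^esub> \<lbrakk>twist L n, \<lbrakk>n', m\<rbrakk>\<^bsub>L\<^esub>\<rbrakk>\<^bsub>L\<^esub>"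
      using mn by (intro bracket_skew closed)
    moreover have "\<lbrakk>\<lbrakk>n, m\<rbrakk>\<^bsub>L\<^esub>, twist L n'\<rbrakk>\<^bsub>L\<^esub> = \<lbrakk>twist L n', \<lbrakk>m, n\<rbrakk>\<^bsub>L\<^esub>\<rbrakk>\<^bsub>L\<^esub>"
      using mn bracket_skew[of "\<lbrakk>n, m\<rbrakk>\<^bsub>L\<^esub>" "twist L n'"] bracket_skew[of m n] by (simp add: bu)
    ultimately show ?thesis
      using hom_jacobi[of m n n'] mn by (simp add: closed a_minus_def M.a_ac)
  qed
  have rel4: "\<lbrakk>\<lbrakk>n, m\<rbrakk>\<^bsub>L\<^esub>, \<lbrakk>m', n'\<rbrakk>\<^bsub>L\<^esub>\<rbrakk>\<^bsub>L\<^esub> \<oplus>\<^bsub>L\<^esub> \<lbrakk>\<lbrakk>n', m'\<rbrakk>\<^bsub>L\<^esub>, \<lbrakk>m, n\<rbrakk>\<^bsub>L\<^esub>\<rbrakk>\<^bsub>L\<^esub> = \<zero>\<^bsub>L\<^esub>"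
    if mn: "m \<in> carrier L" "n \<in> carrier L" "m' \<in> carrier L" "n' \<in> carrier L" for m n m' n'
  proof -
    have "\<lbrakk>\<lbrakk>n, m\<rbrakk>\<^bsub>L\<^esub>, \<lbrakk>m', n'\<rbrakk>\<^bsub>L\<^esub>\<rbrakk>\<^bsub>L\<^esub> = \<ominus>\<^bsub>L\<^esub> \<lbrakk>\<lbrakk>m, n\<rbrakk>\<^bsub>L\<^esub>, \<lbrakk>m', n'\<rbrakk>\<^bsub>L\<^esub>\<rbrakk>\<^bsub>L\<^esub>"
      using mn bracket_skew[of n m] by (simp add: bu)
    moreover have "\<lbrakk>\<lbrakk>n', m'\<rbrakk>\<^bsub>L\<^esub>, \<lbrakk>m, n\<rbrakk>\<^bsub>L\<^esub>\<rbrakk>\<^bsub>L\<^esub> = \<lbrakk>\<lbrakk>m, n\<rbrakk>\<^bsub>L\<^esub>, \<lbrakk>m', n'\<rbrakk>\<^bsub>L\<^esub>\<rbrakk>\<^bsub>L\<^esub>"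
      using mn bracket_skew[of "\<lbrakk>n', m'\<rbrakk>\<^bsub>L\<^esub>" "\<lbrakk>m, n\<rbrakk>\<^bsub>L\<^esub>"] bracket_skew[of m' n'] by (simp add: bu)
    ultimately show ?thesis
      using mn by (simp add: closed M.l_neg)
  qed
  have rel3: "\<lbrakk>\<lbrakk>n, m\<rbrakk>\<^bsub>L\<^esub>, \<lbrakk>m, n\<rbrakk>\<^bsub>L\<^esub>\<rbrakk>\<^bsub>L\<^esub> = \<zero>\<^bsub>L\<^esub>" if mn: "m \<in> carrier L" "n \<in> carrier L" for m n
    using mn bracket_skew[of n m] bracket_alternating[OF two] by (simp add: bu)
  \<comment> \<open>The names \<open>a\<close>, \<open>b\<close>, \<open>c\<close> come with
    equations, discharged at the end by \<open>refl\<close>, so that the Hom-Jacobi identity can be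
    applied to the three inner brackets as units.\<close>
  have rel5: "\<lbrakk>\<lbrakk>a, b\<rbrakk>\<^bsub>L\<^esub>, twist L \<lbrakk>m'', n''\<rbrakk>\<^bsub>L\<^esub>\<rbrakk>\<^bsub>L\<^esub> \<oplus>\<^bsub>L\<^esub> \<lbrakk>\<lbrakk>b, c\<rbrakk>\<^bsub>L\<^esub>, twist L \<lbrakk>m, n\<rbrakk>\<^bsub>L\<^esub>\<rbrakk>\<^bsub>L\<^esub> \<oplus>\<^bsub>L\<^esub>
      \<lbrakk>\<lbrakk>c, a\<rbrakk>\<^bsub>L\<^esub>, twist L \<lbrakk>m', n'\<rbrakk>\<^bsub>L\<^esub>\<rbrakk>\<^bsub>L\<^esub> = \<zero>\<^bsub>L\<^esub>"
    if mn: "m \<in> carrier L" "n \<in> carrier L" "m' \<in> carrier L" "n' \<in> carrier L" "m'' \<in> carrier L"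
      "n'' \<in> carrier L" and abc: "a = \<lbrakk>n, m\<rbrakk>\<^bsub>L\<^esub>" "b = \<lbrakk>n', m'\<rbrakk>\<^bsub>L\<^esub>" "c = \<lbrakk>n'', m''\<rbrakk>\<^bsub>L\<^esub>"
    for m n m' n' m'' n'' a b c
  proof -
    have cl: "a \<in> carrier L" "b \<in> carrier L" "c \<in> carrier L"
      using mn abc by (simp_all add: closed)
    \<comment> \<open>Two sign changes cancel while the twisted entry moves to the first place,
      where the Hom-Jacobi identity expects it.\<close>
    have *: "\<lbrakk>u, twist L \<lbrakk>x, y\<rbrakk>\<^bsub>L\<^esub>\<rbrakk>\<^bsub>L\<^esub> = \<lbrakk>twist L \<lbrakk>y, x\<rbrakk>\<^bsub>L\<^esub>, u\<rbrakk>\<^bsub>L\<^esub>"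
      if "u \<in> carrier L" "x \<in> carrier L" "y \<in> carrier L" for u x y
    proof -
      have "twist L \<lbrakk>x, y\<rbrakk>\<^bsub>L\<^esub> = \<ominus>\<^bsub>L\<^esub> twist L \<lbrakk>y, x\<rbrakk>\<^bsub>L\<^esub>"
        using that bracket_skew[of "twist L x" "twist L y"] by (simp add: twist_bracket closed)
      then show ?thesis
        using that bracket_skew[of u "twist L \<lbrakk>y, x\<rbrakk>\<^bsub>L\<^esub>"] by (simp add: bu)
    qed
    show ?thesis
      using mn cl hom_jacobi[of a b c] by (simp add: * closed abc M.a_ac)
  qed
  show ?thesis
    unfolding star_compatible_def Let_def
    by (intro conjI ballI bracket_linear rel1 rel2 rel3 rel4 rel5 refl)
qed

text \<open>By multiplicativity the twist of \<open>L\<close> is an endomorphism, so pulling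
  \<open>s\<close> back along it keeps compatibility.\<close>

lemma T_twist_linear: "twist T \<in> linear_map K T T"
  and T_twist_elt: "\<lbrakk>m \<in> carrier L; n \<in> carrier L\<rbrakk> \<Longrightarrow> twist T (s m n) = s (twist L m) (twist L n)"
proof -
  have tw: "twist T = star_lift K Q (\<lambda>m n. s (twist L m) (twist L n))"
    by (simp add: star_square_def star_def Let_def)
  note compat = star_compatible_pullback[OF hom_lie_algebra_axioms twist_hom star_elt_compatible_space]
  show "twist T \<in> linear_map K T T"
    unfolding tw linear_map_T by (rule star_lift_linear_space[OF Q_module compat])
  show "twist T (s m n) = s (twist L m) (twist L n)" if "m \<in> carrier L" "n \<in> carrier L"
    unfolding tw by (rule star_lift_elt[OF Q_module compat that])
qed

end

section \<open>Perfect algebras in characteristic other than two\<close>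

locale perfect_hom_lie_algebra = hom_lie_algebra K L
  for K :: "('k, 'r) ring_scheme" (structure) and L :: "('k, 'a) hom_lie" (structure) +
  assumes perfect: "perfect K L" and two_nonzero: "\<one>\<^bsub>K\<^esub> \<oplus>\<^bsub>K\<^esub> \<one>\<^bsub>K\<^esub> \<noteq> \<zero>\<^bsub>K\<^esub>"
begin

abbreviation psi where "psi \<equiv> uce_map K L"

lemma psi_linear: "psi \<in> linear_map K T L"
  unfolding uce_map_def by (rule star_lift_linear[OF L_module bracket_compatible[OF two_nonzero]])

lemma psi_elt: "\<lbrakk>m \<in> carrier L; n \<in> carrier L\<rbrakk> \<Longrightarrow> psi (s m n) = \<lbrakk>m, n\<rbrakk>\<^bsub>L\<^esub>"
  unfolding uce_map_def by (rule star_lift_elt[OF L_module bracket_compatible[OF two_nonzero]])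

lemmas psi_closed = linear_map_closed[OF psi_linear]

lemma perfect_subset:
  assumes "submodule H K L" and "\<And>x y. \<lbrakk>x \<in> carrier L; y \<in> carrier L\<rbrakk> \<Longrightarrow> \<lbrakk>x, y\<rbrakk>\<^bsub>L\<^esub> \<in> H"
  shows "carrier L \<subseteq> H"
proof -
  have "(\<lambda>H. submodule H K L) hull {\<lbrakk>x, y\<rbrakk>\<^bsub>L\<^esub> | x y. x \<in> carrier L \<and> y \<in> carrier L} \<subseteq> H"
    using assms by (intro hull_minimal) auto
  then show ?thesis using perfect by (simp add: perfect_def)
qed

lemma perfect_linear_eqI:
  assumes X: "module K X" and h: "h \<in> linear_map K L X" "g \<in> linear_map K L X"
    and eq: "\<And>x y. \<lbrakk>x \<in> carrier L; y \<in> carrier L\<rbrakk> \<Longrightarrow> h \<lbrakk>x, y\<rbrakk>\<^bsub>L\<^esub> = g \<lbrakk>x, y\<rbrakk>\<^bsub>L\<^esub>"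
    and "x \<in> carrier L"
  shows "h x = g x"
  using perfect_subset[OF submodule_equalizer[OF L_module X h]] assms by (auto simp: bracket_closed)

text \<open>The image is a submodule containing every bracket, so perfectness applies.\<close>

lemma psi_surj: "psi ` carrier T = carrier L"
proof
  show "carrier L \<subseteq> psi ` carrier T"
    using psi_elt[symmetric] star_elt_closed
    by (intro perfect_subset submodule_image[OF T_module L_module psi_linear]) auto
qed (use psi_closed in auto)

lemma psi_surj_pair:
  assumes "m \<in> carrier L" "n \<in> carrier L"
  obtains c d where "c \<in> carrier T" "psi c = m" "d \<in> carrier T" "psi d = n"
  using assms unfolding psi_surj[symmetric] by (elim imageE) blast

text \<open>The sign in the definition is absorbed by \<open>[n, m] = - [m, n]\<close>. Each of the
  nested lifts then prescribes values that already come from a linear map, first in \<open>d\<close>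
  and then in \<open>c\<close>, so \<open>star_lift_unique\<close> evaluates it.\<close>

lemma T_bracket:
  assumes c: "c \<in> carrier T" and d: "d \<in> carrier T"
  shows "\<lbrakk>c, d\<rbrakk>\<^bsub>T\<^esub> = s (psi c) (psi d)"
proof -
  note lin = star_elt_linear[unfolded linear_map_T]
  have psi: "psi \<in> linear_map K Q L" using psi_linear by (simp add: linear_map_T)
  have inner: "star_lift K Q (\<lambda>m' n'. \<ominus>\<^bsub>Q\<^esub> s \<lbrakk>n, m\<rbrakk>\<^bsub>L\<^esub> \<lbrakk>m', n'\<rbrakk>\<^bsub>L\<^esub>) d = s \<lbrakk>m, n\<rbrakk>\<^bsub>L\<^esub> (psi d)"
    if mn: "m \<in> carrier L" "n \<in> carrier L" for m n
  proof (rule star_lift_unique[OF Q_module])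
    show "(\<lambda>d. s \<lbrakk>m, n\<rbrakk>\<^bsub>L\<^esub> (psi d)) \<in> linear_map K Q Q"
      using mn by (intro linear_map_compose[OF psi] lin(2) bracket_closed)
    fix m' n' assume "m' \<in> carrier L" "n' \<in> carrier L"
    then show "\<ominus>\<^bsub>Q\<^esub> s \<lbrakk>n, m\<rbrakk>\<^bsub>L\<^esub> \<lbrakk>m', n'\<rbrakk>\<^bsub>L\<^esub> = s \<lbrakk>m, n\<rbrakk>\<^bsub>L\<^esub> (psi (s m' n'))"
      using mn linear_map_uminus[OF L_module Q_module lin(1), of "\<lbrakk>m', n'\<rbrakk>\<^bsub>L\<^esub>" "\<lbrakk>n, m\<rbrakk>\<^bsub>L\<^esub>"]
        bracket_skew[of m n] by (simp add: psi_elt bracket_closed)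
  qed (use d in simp)
  have "star_lift K Q (\<lambda>m n. star_lift K Q (\<lambda>m' n'. \<ominus>\<^bsub>Q\<^esub> s \<lbrakk>n, m\<rbrakk>\<^bsub>L\<^esub> \<lbrakk>m', n'\<rbrakk>\<^bsub>L\<^esub>) d) c =
      s (psi c) (psi d)"
  proof (rule star_lift_unique[OF Q_module])
    show "(\<lambda>c. s (psi c) (psi d)) \<in> linear_map K Q Q"
      using d psi_closed by (intro linear_map_compose[OF psi] lin(1)) simp
  qed (use c in \<open>simp_all add: inner psi_elt\<close>)
  then show ?thesis
    by (simp add: star_square_def star_def Let_def)
qed

lemma star_elt_uminus:
  assumes "x \<in> carrier L" "y \<in> carrier L"
  shows "s (\<ominus>\<^bsub>L\<^esub> x) y = \<ominus>\<^bsub>T\<^esub> s x y"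
  using linear_map_uminus[OF L_module T_module star_elt_linear(1)] assms by simp

text \<open>Relation (iv) gives this only when both arguments are brackets; perfectness extends it
  to all elements, one argument at a time.\<close>

lemma star_elt_skew:
  assumes x: "x \<in> carrier L" and y: "y \<in> carrier L"
  shows "s x y = \<ominus>\<^bsub>T\<^esub> s y x"
proof -
  interpret T: module K T by (rule T_module)
  have neg: "uminus_T \<in> linear_map K T T" if "uminus_T = a_inv T" for uminus_T
    unfolding that by (rule linear_mapI) (auto simp: T.minus_add T.smult_r_minus simp del: T_simps)
  have lin: "(\<lambda>x. \<ominus>\<^bsub>T\<^esub> s y x) \<in> linear_map K L T" "(\<lambda>x. \<ominus>\<^bsub>T\<^esub> s x y) \<in> linear_map K L T"
    if "y \<in> carrier L" for y
    by (rule linear_map_compose[OF _ neg[OF refl]], rule star_elt_linear[OF that])+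
  have brackets: "s \<lbrakk>m, n\<rbrakk>\<^bsub>L\<^esub> \<lbrakk>m', n'\<rbrakk>\<^bsub>L\<^esub> = \<ominus>\<^bsub>T\<^esub> s \<lbrakk>m', n'\<rbrakk>\<^bsub>L\<^esub> \<lbrakk>m, n\<rbrakk>\<^bsub>L\<^esub>"
    if mn: "m \<in> carrier L" "n \<in> carrier L" "m' \<in> carrier L" "n' \<in> carrier L" for m n m' n'
  proof -
    note closed = bracket_closed star_elt_closed
    have eq: "s \<lbrakk>n, m\<rbrakk>\<^bsub>L\<^esub> \<lbrakk>m', n'\<rbrakk>\<^bsub>L\<^esub> \<oplus>\<^bsub>T\<^esub> s \<lbrakk>n', m'\<rbrakk>\<^bsub>L\<^esub> \<lbrakk>m, n\<rbrakk>\<^bsub>L\<^esub> = \<zero>\<^bsub>T\<^esub>"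
      by (rule star_compatibleD(4)[OF star_elt_compatible]) fact+
    then have "\<ominus>\<^bsub>T\<^esub> s \<lbrakk>n', m'\<rbrakk>\<^bsub>L\<^esub> \<lbrakk>m, n\<rbrakk>\<^bsub>L\<^esub> = s \<lbrakk>n, m\<rbrakk>\<^bsub>L\<^esub> \<lbrakk>m', n'\<rbrakk>\<^bsub>L\<^esub>"
      using mn by (intro T.minus_equality closed)
    then show ?thesis
      using mn bracket_skew[of m n] bracket_skew[of m' n'] star_elt_uminus closed
      by (simp del: T_simps)
  qed
  \<comment> \<open>The first argument is now arbitrary, the second still a bracket.\<close>
  have half: "s x \<lbrakk>m', n'\<rbrakk>\<^bsub>L\<^esub> = \<ominus>\<^bsub>T\<^esub> s \<lbrakk>m', n'\<rbrakk>\<^bsub>L\<^esub> x"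
    if mn: "m' \<in> carrier L" "n' \<in> carrier L" for m' n'
    by (rule perfect_linear_eqI[OF T_module star_elt_linear(1) lin(1) brackets x])
      (use mn in \<open>auto intro: bracket_closed\<close>)
  show ?thesis
    by (rule perfect_linear_eqI[OF T_module star_elt_linear(2)[OF x] lin(2)[OF x] half y])
qed

lemma T_twist_psi:
  assumes "c \<in> carrier T"
  shows "psi (twist T c) = twist L (psi c)"
  by (rule T_linear_eqI[OF L_module _ _ _ assms])
    (auto intro: linear_map_compose[OF T_twist_linear psi_linear]
      linear_map_compose[OF psi_linear hom_lie_homD(1)[OF twist_hom]]
      simp: T_twist_elt psi_elt twist_closed twist_bracket)

text \<open>With the bracket written as \<open>s (psi c) (psi d)\<close>, the axioms become
  statements about \<open>s\<close> and \<open>psi\<close>; the Hom-Jacobi identity is relation (ii)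
  after reordering arguments by skew-symmetry.\<close>

lemma T_hom_lie_algebra: "hom_lie_algebra K T"
proof -
  interpret T: module K T by (rule T_module)
  note lin = star_elt_linear and cl = psi_closed star_elt_closed linear_map_closed[OF T_twist_linear]
    bracket_closed twist_closed
  have jacobi: "s (twist L x) \<lbrakk>y, z\<rbrakk>\<^bsub>L\<^esub> \<oplus>\<^bsub>T\<^esub> s (twist L z) \<lbrakk>x, y\<rbrakk>\<^bsub>L\<^esub> \<oplus>\<^bsub>T\<^esub> s (twist L y) \<lbrakk>z, x\<rbrakk>\<^bsub>L\<^esub> =
      \<zero>\<^bsub>T\<^esub>" if xyz: "x \<in> carrier L" "y \<in> carrier L" "z \<in> carrier L" for x y z
  proof -
    have "s \<lbrakk>z, x\<rbrakk>\<^bsub>L\<^esub> (twist L y) = \<ominus>\<^bsub>T\<^esub> s (twist L y) \<lbrakk>z, x\<rbrakk>\<^bsub>L\<^esub>"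
      using xyz by (intro star_elt_skew cl)
    moreover have "s \<lbrakk>y, x\<rbrakk>\<^bsub>L\<^esub> (twist L z) = s (twist L z) \<lbrakk>x, y\<rbrakk>\<^bsub>L\<^esub>"
      using xyz bracket_skew[of y x] star_elt_uminus star_elt_skew[of "twist L z" "\<lbrakk>x, y\<rbrakk>\<^bsub>L\<^esub>"]
      by (simp add: cl del: T_simps)
    ultimately show ?thesis
      using star_compatibleD(3)[OF star_elt_compatible xyz] xyz
      by (simp add: a_minus_def cl T.a_ac del: T_simps)
  qed
  have psi_bracket: "psi (s (psi x) (psi y)) = \<lbrakk>psi x, psi y\<rbrakk>\<^bsub>L\<^esub>"
    if "x \<in> carrier T" "y \<in> carrier T" for x y
    using that by (simp add: psi_elt cl del: T_simps)
  have skew: "\<lbrakk>x, y\<rbrakk>\<^bsub>T\<^esub> = \<ominus>\<^bsub>T\<^esub> \<lbrakk>y, x\<rbrakk>\<^bsub>T\<^esub>" if "x \<in> carrier T" "y \<in> carrier T" for x y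
    using that star_elt_skew[of "psi x" "psi y"] by (simp add: T_bracket cl del: T_simps)
  show ?thesis
    by (intro hom_lie_algebra.intro hom_lie_algebra_axioms.intro field_axioms T_module skew)
      (simp_all add: T_bracket cl psi_bracket T_twist_psi T_twist_elt jacobi
        linear_map_add[OF psi_linear] linear_map_smult[OF psi_linear]
        linear_map_add[OF T_twist_linear] linear_map_smult[OF T_twist_linear]
        linear_map_add[OF lin(1)] linear_map_add[OF lin(2)]
        linear_map_smult[OF lin(1)] linear_map_smult[OF lin(2)]
        del: T_simps)
qed

lemma psi_hom: "psi \<in> hom_lie_hom K T L"
  by (rule hom_lie_homI[OF psi_linear]) (auto simp: T_bracket psi_elt psi_closed T_twist_psi simp del: T_simps)

lemma T_perfect: "perfect K T"
proof -
  interpret T: hom_lie_algebra K T by (rule T_hom_lie_algebra)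
  let ?B = "{\<lbrakk>x, y\<rbrakk>\<^bsub>T\<^esub> | x y. x \<in> carrier T \<and> y \<in> carrier T}"
  have sub: "submodule ((\<lambda>H. submodule H K T) hull ?B) K T"
    by (rule submodule_hull[OF T_module]) (auto simp: T.bracket_closed simp del: T_simps)
  have "s m n \<in> (\<lambda>H. submodule H K T) hull ?B" if mn: "m \<in> carrier L" "n \<in> carrier L" for m n
  proof (rule hull_inc)
    obtain c d where cd: "c \<in> carrier T" "psi c = m" "d \<in> carrier T" "psi d = n"
      using mn by (rule psi_surj_pair)
    then have "s m n = \<lbrakk>c, d\<rbrakk>\<^bsub>T\<^esub>" using T_bracket[OF cd(1,3)] by simp
    then show "s m n \<in> ?B" using cd by blast
  qed
  then have "carrier T \<subseteq> (\<lambda>H. submodule H K T) hull ?B"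
    by (rule T_spanned[OF sub])
  then show ?thesis
    unfolding perfect_def using T.submoduleE(1)[OF sub] by (rule subset_antisym)
qed

lemma T_central_extension: "central_extension K T psi L"
proof -
  interpret T: hom_lie_algebra K T by (rule T_hom_lie_algebra)
  \<comment> \<open>This is the bracket with a kernel element, whose image under \<open>psi\<close>
    is zero.\<close>
  have "s \<zero>\<^bsub>L\<^esub> y = \<zero>\<^bsub>T\<^esub>" if "y \<in> carrier L" for y
    using linear_map_zero[OF L_module T_module star_elt_linear(1)[OF that]] .
  then show ?thesis
    unfolding central_extension_def
    using T_hom_lie_algebra hom_lie_algebra_axioms psi_hom psi_surj
    by (auto simp: a_kernel_def' T_bracket psi_closed simp del: T_simps)
qed

theorem T_universal: "universal_central_extension TYPE('c) K T psi L"
  unfolding universal_central_extension_def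
proof (intro conjI allI impI T_central_extension)
  fix C :: "('k, 'c) hom_lie" and c
  assume "central_extension K C c L"
  then have C: "hom_lie_algebra K C" and c: "c \<in> hom_lie_hom K C L"
    and surj: "c ` carrier C = carrier L"
    and central: "\<And>x y. \<lbrakk>x \<in> carrier C; c x = \<zero>\<^bsub>L\<^esub>; y \<in> carrier C\<rbrakk> \<Longrightarrow> \<lbrakk>x, y\<rbrakk>\<^bsub>C\<^esub> = \<zero>\<^bsub>C\<^esub>"
    by (auto simp: central_extension_def a_kernel_def')
  interpret C: hom_lie_algebra K C by fact
  note c_lin = hom_lie_homD(1)[OF c] and c_closed = hom_lie_homD(2)[OF c]
  \<comment> \<open>Elements with the same image differ by an element of the kernel, which is
    central.\<close>
  have left: "\<lbrakk>x, y\<rbrakk>\<^bsub>C\<^esub> = \<lbrakk>x', y\<rbrakk>\<^bsub>C\<^esub>"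
    if "x \<in> carrier C" "x' \<in> carrier C" "y \<in> carrier C" "c x = c x'" for x x' y
  proof -
    have "c (x \<ominus>\<^bsub>C\<^esub> x') = \<zero>\<^bsub>L\<^esub>"
      using that linear_map_minus[OF C.L_module L_module c_lin] c_closed
      by (simp add: M.minus_eq_iff)
    then have "\<lbrakk>x \<ominus>\<^bsub>C\<^esub> x', y\<rbrakk>\<^bsub>C\<^esub> = \<zero>\<^bsub>C\<^esub>"
      using that by (intro central) auto
    then show ?thesis
      using that linear_map_minus[OF C.L_module C.L_module C.bracket_linear(1)]
      by (simp add: C.M.minus_eq_iff C.bracket_closed)
  qed
  have bracket_eq: "\<lbrakk>x, y\<rbrakk>\<^bsub>C\<^esub> = \<lbrakk>x', y'\<rbrakk>\<^bsub>C\<^esub>"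
    if "x \<in> carrier C" "x' \<in> carrier C" "y \<in> carrier C" "y' \<in> carrier C" "c x = c x'" "c y = c y'"
    for x x' y y'
    using that left[of x x' y] left[of y y' x'] C.bracket_skew[of x' y] C.bracket_skew[of x' y'] by simp
  \<comment> \<open>\<sigma> is a mere set-theoretic section of \<open>c\<close>. Linearity of
    \<open>b\<close> is recovered from \<open>bracket_eq\<close>, which makes \<open>b\<close>
    independent of the choice of preimages.\<close>
  define \<sigma> where "\<sigma> = inv_into (carrier C) c"
  have \<sigma>: "\<sigma> m \<in> carrier C" "c (\<sigma> m) = m" if "m \<in> carrier L" for m
    using that surj by (auto simp: \<sigma>_def inv_into_into f_inv_into_f)
  define b where "b = (\<lambda>m n. \<lbrakk>\<sigma> m, \<sigma> n\<rbrakk>\<^bsub>C\<^esub>)"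
  have b: "b (c x) (c y) = \<lbrakk>x, y\<rbrakk>\<^bsub>C\<^esub>" if "x \<in> carrier C" "y \<in> carrier C" for x y
    unfolding b_def using that \<sigma> c_closed by (intro bracket_eq) auto
  have compat: "star_compatible K L C b"
    by (rule star_compatible_pushforward[OF C c surj C.bracket_compatible[OF two_nonzero] b])
  \<comment> \<open>The restriction meets the extensionality clause of the universal
    property.\<close>
  define f where "f = restrict (star_lift K C b) (carrier T)"
  interpret T: hom_lie_algebra K T by (rule T_hom_lie_algebra)
  have f_lin: "f \<in> linear_map K T C"
    using star_lift_linear[OF C.L_module compat]
    by (auto simp: f_def linear_map_def simp del: T_simps)
  note f_closed = linear_map_closed[OF f_lin]
  have f_elt: "f (s m n) = b m n" if "m \<in> carrier L" "n \<in> carrier L" for m n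
    using that star_lift_elt[OF C.L_module compat] star_elt_closed by (simp add: f_def del: T_simps)
  have over: "c (f t) = psi t" if "t \<in> carrier T" for t
    by (rule T_linear_eqI[OF L_module linear_map_compose[OF f_lin c_lin] psi_linear _ that])
      (simp add: f_elt b_def psi_elt hom_lie_homD(3)[OF c] \<sigma>)
  have f_hom: "f \<in> hom_lie_hom K T C"
  proof (rule hom_lie_homI[OF f_lin])
    show "f \<lbrakk>x, y\<rbrakk>\<^bsub>T\<^esub> = \<lbrakk>f x, f y\<rbrakk>\<^bsub>C\<^esub>" if "x \<in> carrier T" "y \<in> carrier T" for x y
      \<comment> \<open>Reading \<open>psi x\<close> as \<open>c (f x)\<close> lets \<open>b\<close>
        be evaluated at the preimages \<open>f x\<close> and \<open>f y\<close>.\<close>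
      using that by (simp add: T_bracket f_elt psi_closed over[symmetric] b f_closed c_closed del: T_simps)
    show "f (twist T x) = twist C (f x)" if "x \<in> carrier T" for x
    proof (rule T_linear_eqI[OF C.L_module linear_map_compose[OF T_twist_linear f_lin]
          linear_map_compose[OF f_lin hom_lie_homD(1)[OF C.twist_hom]] _ that])
      fix m n assume mn: "m \<in> carrier L" "n \<in> carrier L"
      \<comment> \<open>The twist of \<open>\<sigma> m\<close> need not be the chosen preimage of
        \<open>twist L m\<close>, but it is one, which suffices for \<open>b\<close>.\<close>
      have "b (twist L m) (twist L n) = b (c (twist C (\<sigma> m))) (c (twist C (\<sigma> n)))"
        using mn \<sigma> by (simp add: hom_lie_homD(4)[OF c])
      also have "\<dots> = \<lbrakk>twist C (\<sigma> m), twist C (\<sigma> n)\<rbrakk>\<^bsub>C\<^esub>"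
        using mn \<sigma> by (intro b C.twist_closed) auto
      finally show "f (twist T (s m n)) = twist C (f (s m n))"
        using mn \<sigma> by (simp add: T_twist_elt f_elt twist_closed b_def C.twist_bracket)
    qed
  qed
  \<comment> \<open>Each generator of \<open>T\<close> is a bracket of some \<open>u\<close> and
    \<open>v\<close>. Two maps over \<open>L\<close> send \<open>u\<close> and \<open>v\<close> to
    elements with equal images in \<open>L\<close>, hence agree on the bracket by
    \<open>bracket_eq\<close>.\<close>
  have unique: "g = f" if g: "g \<in> hom_lie_hom K T C" "g \<in> extensional (carrier T)"
    "\<forall>x\<in>carrier T. c (g x) = psi x" for g
  proof (rule extensionalityI[OF g(2)])
    show "f \<in> extensional (carrier T)" by (simp add: f_def)
    fix x assume x: "x \<in> carrier T"
    show "g x = f x"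
    proof (rule T_linear_eqI[OF C.L_module hom_lie_homD(1)[OF g(1)] f_lin _ x])
      fix m n assume "m \<in> carrier L" "n \<in> carrier L"
      then obtain u v where uv: "u \<in> carrier T" "psi u = m" "v \<in> carrier T" "psi v = n"
        by (rule psi_surj_pair)
      then have "g (s m n) = \<lbrakk>g u, g v\<rbrakk>\<^bsub>C\<^esub>"
        using hom_lie_homD(3)[OF g(1) uv(1,3)] T_bracket[OF uv(1,3)] by simp
      also have "\<dots> = \<lbrakk>f u, f v\<rbrakk>\<^bsub>C\<^esub>"
        using uv g over by (intro bracket_eq hom_lie_homD(2)[OF g(1)] f_closed) auto
      also have "\<dots> = f (s m n)"
        using uv hom_lie_homD(3)[OF f_hom uv(1,3)] T_bracket[OF uv(1,3)] by simp
      finally show "g (s m n) = f (s m n)" .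
    qed
  qed
  show "\<exists>!f. f \<in> hom_lie_hom K T C \<and> f \<in> extensional (carrier T) \<and>
      (\<forall>x\<in>carrier T. c (f x) = psi x)"
    using over f_hom by (intro ex1I[of _ f] unique) (auto simp: f_def simp del: T_simps)
qed

end


section \<open>Isomorphisms and universal central extensions\<close>

lemma hom_lie_hom_inv:
  assumes L: "hom_lie_algebra K L" and f: "f \<in> hom_lie_hom K L L'"
    and bij: "bij_betw f (carrier L) (carrier L')"
  shows "inv_into (carrier L) f \<in> hom_lie_hom K L' L"
proof -
  interpret L: hom_lie_algebra K L by fact
  let ?g = "inv_into (carrier L) f"
  have g: "?g y \<in> carrier L" "f (?g y) = y" if "y \<in> carrier L'" for y
    using that bij by (auto simp: bij_betw_def inv_into_into f_inv_into_f)
  have eqI: "?g y = x" if "x \<in> carrier L" "f x = y" for x y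
    using that bij by (auto simp: bij_betw_def)
  show ?thesis
  proof (intro hom_lie_homI linear_mapI)
  qed (use g hom_lie_homD[OF f] in \<open>auto intro!: eqI simp: L.bracket_closed L.twist_closed
      linear_map_add[OF hom_lie_homD(1)[OF f]] linear_map_smult[OF hom_lie_homD(1)[OF f]]\<close>)
qed

lemma hom_lie_isomorphic_trans:
  assumes "hom_lie_isomorphic K L L'" and "hom_lie_isomorphic K L' L''"
  shows "hom_lie_isomorphic K L L''"
proof -
  obtain f g where "f \<in> hom_lie_hom K L L'" "bij_betw f (carrier L) (carrier L')"
    "g \<in> hom_lie_hom K L' L''" "bij_betw g (carrier L') (carrier L'')"
    using assms by (auto simp: hom_lie_isomorphic_def)
  then have "(\<lambda>x. g (f x)) \<in> hom_lie_hom K L L''" "bij_betw (\<lambda>x. g (f x)) (carrier L) (carrier L'')"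
    using hom_lie_hom_compose bij_betw_trans[of f _ _ g] by (auto simp: comp_def)
  then show ?thesis by (auto simp: hom_lie_isomorphic_def)
qed

text \<open>The preimage of the span of brackets in \<open>L'\<close> is a submodule containing all
  brackets of \<open>L\<close>.\<close>

lemma perfect_image:
  assumes L: "hom_lie_algebra K L" and L': "hom_lie_algebra K L'" and f: "f \<in> hom_lie_hom K L L'"
    and surj: "f ` carrier L = carrier L'" and perfect: "perfect K L"
  shows "perfect K L'"
proof -
  interpret L: hom_lie_algebra K L by fact
  interpret L': hom_lie_algebra K L' by fact
  note h = hom_lie_homD[OF f]
  let ?B = "{\<lbrakk>x, y\<rbrakk>\<^bsub>L\<^esub> | x y. x \<in> carrier L \<and> y \<in> carrier L}"
  let ?B' = "{\<lbrakk>x, y\<rbrakk>\<^bsub>L'\<^esub> | x y. x \<in> carrier L' \<and> y \<in> carrier L'}"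
  let ?H = "(\<lambda>H. submodule H K L') hull ?B'"
  have sub: "submodule ?H K L'"
    by (rule submodule_hull[OF L'.L_module]) (auto simp: L'.bracket_closed)
  have "?B \<subseteq> {x \<in> carrier L. f x \<in> ?H}"
    using h(2,3) by (fastforce simp: L.bracket_closed intro: hull_inc)
  then have "(\<lambda>H. submodule H K L) hull ?B \<subseteq> {x \<in> carrier L. f x \<in> ?H}"
    by (rule hull_minimal) (rule submodule_vimage[OF L.L_module L'.L_module h(1) sub])
  then have "carrier L \<subseteq> {x \<in> carrier L. f x \<in> ?H}"
    using perfect by (simp add: perfect_def)
  then have "carrier L' \<subseteq> ?H"
    unfolding surj[symmetric] by blast
  then show ?thesis
    unfolding perfect_def using L'.submoduleE(1)[OF sub] by (rule subset_antisym)
qed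

text \<open>Extensionality makes functions on the carrier literally unique. It is dropped here:
  arbitrary homomorphisms are restricted first, so uniqueness becomes equality on the
  carrier.\<close>

lemma universal_central_extensionD:
  fixes U :: "('k, 'u) hom_lie" and C :: "('k, 'c) hom_lie"
  assumes "universal_central_extension TYPE('c) K U u L"
  shows "central_extension K U u L"
    and "central_extension K C c L \<Longrightarrow> \<exists>f. f \<in> hom_lie_hom K U C \<and> (\<forall>x\<in>carrier U. c (f x) = u x)"
    and "\<lbrakk>central_extension K C c L; f \<in> hom_lie_hom K U C; g \<in> hom_lie_hom K U C;
      \<And>x. x \<in> carrier U \<Longrightarrow> c (f x) = u x; \<And>x. x \<in> carrier U \<Longrightarrow> c (g x) = u x; x \<in> carrier U\<rbrakk> \<Longrightarrow>
      f x = g x"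
proof -
  show "central_extension K U u L"
    using assms by (simp add: universal_central_extension_def)
  assume C: "central_extension K C c L"
  have ex1: "\<exists>!f. f \<in> hom_lie_hom K U C \<and> f \<in> extensional (carrier U) \<and>
      (\<forall>x\<in>carrier U. c (f x) = u x)"
    using assms C by (simp add: universal_central_extension_def)
  then show "\<exists>f. f \<in> hom_lie_hom K U C \<and> (\<forall>x\<in>carrier U. c (f x) = u x)" by blast
  assume f: "f \<in> hom_lie_hom K U C" "\<And>x. x \<in> carrier U \<Longrightarrow> c (f x) = u x"
    and g: "g \<in> hom_lie_hom K U C" "\<And>x. x \<in> carrier U \<Longrightarrow> c (g x) = u x" and x: "x \<in> carrier U"
  have U: "hom_lie_algebra K U"
    using \<open>central_extension K U u L\<close> by (simp add: central_extension_def)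
  interpret U: hom_lie_algebra K U by fact
  have restrict: "restrict h (carrier U) \<in> hom_lie_hom K U C"
    if "h \<in> hom_lie_hom K U C" for h
    using that by (auto simp: hom_lie_hom_def U.bracket_closed U.twist_closed)
  have "a = b" if "\<exists>!x. P x" "P a" "P b" for P and a b :: "'u \<Rightarrow> 'c"
    using that by blast
  from this[OF ex1] have "restrict f (carrier U) = restrict g (carrier U)"
    using f g restrict by simp
  then show "f x = g x" using x by (metis restrict_apply')
qed

text \<open>The usual argument for initial objects: both composites are compared with the identity.
  Each object is tested against the type of the other to obtain a map and against its own type to
  identify the composite, hence four hypotheses.\<close>

lemma universal_central_extension_unique:
  fixes U :: "('k, 'u) hom_lie" and V :: "('k, 'v) hom_lie"
  assumes UU: "universal_central_extension TYPE('u) K U u L"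
    and UV: "universal_central_extension TYPE('v) K U u L"
    and VU: "universal_central_extension TYPE('u) K V v L"
    and VV: "universal_central_extension TYPE('v) K V v L"
  shows "\<exists>f. f \<in> hom_lie_hom K U V \<and> bij_betw f (carrier U) (carrier V)"
proof -
  note U = universal_central_extensionD(1)[OF UU] and V = universal_central_extensionD(1)[OF VV]
  obtain f where f: "f \<in> hom_lie_hom K U V" "\<And>x. x \<in> carrier U \<Longrightarrow> v (f x) = u x"
    using universal_central_extensionD(2)[OF UV V] by blast
  obtain g where g: "g \<in> hom_lie_hom K V U" "\<And>x. x \<in> carrier V \<Longrightarrow> u (g x) = v x"
    using universal_central_extensionD(2)[OF VU U] by blast
  note closed = hom_lie_homD(2)[OF f(1)] hom_lie_homD(2)[OF g(1)]
  have id: "(\<lambda>x. x) \<in> hom_lie_hom K L L" for L :: "('k, 'x) hom_lie"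
    by (auto simp: hom_lie_hom_def)
  have "g (f x) = x" if "x \<in> carrier U" for x
    using closed f(2) g(2)
    by (intro universal_central_extensionD(3)[OF UU U hom_lie_hom_compose[OF f(1) g(1)] id _ _ that]) auto
  moreover have "f (g x) = x" if "x \<in> carrier V" for x
    using closed f(2) g(2)
    by (intro universal_central_extensionD(3)[OF VV V hom_lie_hom_compose[OF g(1) f(1)] id _ _ that]) auto
  ultimately have "bij_betw f (carrier U) (carrier V)"
    using closed by (intro bij_betwI[of f _ _ g]) auto
  with f show ?thesis by blast
qed

lemma central_extension_compose:
  assumes C: "central_extension K C c L" and L': "hom_lie_algebra K L'"
    and f: "f \<in> hom_lie_hom K L L'" and bij: "bij_betw f (carrier L) (carrier L')"
  shows "central_extension K C (\<lambda>x. f (c x)) L'"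
proof -
  from C have L: "hom_lie_algebra K L" and c: "c \<in> hom_lie_hom K C L"
    and surj: "c ` carrier C = carrier L"
    by (simp_all add: central_extension_def)
  interpret L: hom_lie_algebra K L by fact
  interpret L': hom_lie_algebra K L' by fact
  have "f y = \<zero>\<^bsub>L'\<^esub> \<longleftrightarrow> y = \<zero>\<^bsub>L\<^esub>" if "y \<in> carrier L" for y
    using bij that linear_map_zero[OF L.L_module L'.L_module hom_lie_homD(1)[OF f]]
    by (metis L.zero_closed bij_betw_def inj_on_eq_iff)
  then have "a_kernel C L' (\<lambda>x. f (c x)) = a_kernel C L c"
    using hom_lie_homD(2)[OF c] by (auto simp: a_kernel_def')
  moreover have "(\<lambda>x. f (c x)) ` carrier C = carrier L'"
    using surj bij by (metis bij_betw_def image_image)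
  ultimately show ?thesis
    using C L' hom_lie_hom_compose[OF c f] by (simp add: central_extension_def)
qed

text \<open>Composing with the inverse of \<open>f\<close> makes any central extension of
  \<open>L'\<close> one of \<open>L\<close>, and the two conditions on a map out of \<open>U\<close>
  are equivalent. This moves \<open>W \<star> W\<close> from base \<open>W\<close> to base
  \<open>G \<star> G\<close>.\<close>

lemma universal_central_extension_compose:
  fixes L' :: "('k, 'l) hom_lie"
  assumes U: "universal_central_extension TYPE('c) K U u L" and L': "hom_lie_algebra K L'"
    and f: "f \<in> hom_lie_hom K L L'" and bij: "bij_betw f (carrier L) (carrier L')"
  shows "universal_central_extension TYPE('c) K U (\<lambda>x. f (u x)) L'"
  unfolding universal_central_extension_def
proof (intro conjI allI impI)
  note ext = universal_central_extensionD(1)[OF U]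
  then have L: "hom_lie_algebra K L" and u: "u \<in> hom_lie_hom K U L"
    by (simp_all add: central_extension_def)
  show "central_extension K U (\<lambda>x. f (u x)) L'"
    by (rule central_extension_compose[OF ext L' f bij])
  fix C :: "('k, 'c) hom_lie" and c
  assume C: "central_extension K C c L'"
  let ?g = "inv_into (carrier L) f"
  have "central_extension K C (\<lambda>x. ?g (c x)) L"
    by (rule central_extension_compose[OF C L hom_lie_hom_inv[OF L f bij] bij_betw_inv_into[OF bij]])
  then have "\<exists>!h. h \<in> hom_lie_hom K U C \<and> h \<in> extensional (carrier U) \<and>
      (\<forall>x\<in>carrier U. ?g (c (h x)) = u x)"
    using U unfolding universal_central_extension_def by blast
  moreover have "?g (c (h x)) = u x \<longleftrightarrow> c (h x) = f (u x)"
    if "h \<in> hom_lie_hom K U C" "x \<in> carrier U" for h x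
  proof -
    have "c (h x) \<in> carrier L'" "u x \<in> carrier L"
      using that C hom_lie_homD(2)[OF u] by (auto simp: central_extension_def hom_lie_hom_def)
    then show ?thesis
      using bij by (metis bij_betw_inv_into_left bij_betw_inv_into_right)
  qed
  ultimately show "\<exists>!h. h \<in> hom_lie_hom K U C \<and> h \<in> extensional (carrier U) \<and>
      (\<forall>x\<in>carrier U. c (h x) = f (u x))"
    by (simp cong: conj_cong)
qed

text \<open>The first conjunct concerns the tensor models of the universal central extensions, the
  second arbitrary ones \<open>W\<close> and \<open>V\<close>. Universality of \<open>W\<close> and
  \<open>V\<close> is required for their own type and that of the respective tensor model, as the
  uniqueness argument demands.\<close>

theorem corollary6p7:
  fixes K :: "('k, 'r) ring_scheme" and G :: "('k, 'a) hom_lie"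
    and W :: "('k, 'w) hom_lie" and w :: "'w \<Rightarrow> 'a"
    and V :: "('k, 'v) hom_lie" and v :: "'v \<Rightarrow> ('k, 'a) star_elem"
  assumes "hom_lie_algebra K G"
    and "perfect K G"
    and "twist G ` carrier G = carrier G"
    and "H2 K (star_square K G) = eta K G ` carrier (eta_domain K G)"
  shows "hom_lie_isomorphic K (uce K (star_square K G)) (star_square K (uce K G)) \<and>
    (\<one>\<^bsub>K\<^esub> \<oplus>\<^bsub>K\<^esub> \<one>\<^bsub>K\<^esub> \<noteq> \<zero>\<^bsub>K\<^esub> \<longrightarrow>
     universal_central_extension TYPE('w) K W w G \<longrightarrow>
     universal_central_extension TYPE(('k, 'a) star_elem) K W w G \<longrightarrow>
     universal_central_extension TYPE('v) K V v (star_square K G) \<longrightarrow>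
     universal_central_extension TYPE(('k, ('k, 'a) star_elem) star_elem) K V v (star_square K G) \<longrightarrow>
     hom_lie_isomorphic K V (star_square K W))"
proof (intro conjI impI)
  show "hom_lie_isomorphic K (uce K (star_square K G)) (star_square K (uce K G))"
    unfolding uce_def hom_lie_isomorphic_def
    by (intro bexI[of _ "\<lambda>x. x"]) (auto simp: hom_lie_hom_def bij_betw_def)
next
  assume two: "\<one>\<^bsub>K\<^esub> \<oplus>\<^bsub>K\<^esub> \<one>\<^bsub>K\<^esub> \<noteq> \<zero>\<^bsub>K\<^esub>"
    and W: "universal_central_extension TYPE('w) K W w G"
      "universal_central_extension TYPE(('k, 'a) star_elem) K W w G"
    and V: "universal_central_extension TYPE('v) K V v (star_square K G)"
      "universal_central_extension TYPE(('k, ('k, 'a) star_elem) star_elem) K V v (star_square K G)"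
  let ?U = "star_square K G"
  interpret G: perfect_hom_lie_algebra K G
    using assms(1,2) two by (intro perfect_hom_lie_algebra.intro perfect_hom_lie_algebra_axioms.intro)
  interpret U: perfect_hom_lie_algebra K ?U
    using G.T_hom_lie_algebra G.T_perfect two
    by (intro perfect_hom_lie_algebra.intro perfect_hom_lie_algebra_axioms.intro)
  have W_alg: "hom_lie_algebra K W"
    using W(1) by (simp add: universal_central_extension_def central_extension_def)
  obtain f where f: "f \<in> hom_lie_hom K W ?U" "bij_betw f (carrier W) (carrier ?U)"
    using universal_central_extension_unique[OF W G.T_universal G.T_universal] by blast
  \<comment> \<open>The inverse maps \<open>G \<star> G\<close> onto \<open>W\<close>, so
    \<open>W\<close> inherits perfectness.\<close>
  have inv: "inv_into (carrier W) f \<in> hom_lie_hom K ?U W"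
    "inv_into (carrier W) f ` carrier ?U = carrier W"
    using hom_lie_hom_inv[OF W_alg f] bij_betw_inv_into[OF f(2)] by (auto simp: bij_betw_def)
  interpret W: perfect_hom_lie_algebra K W
    using W_alg perfect_image[OF G.T_hom_lie_algebra W_alg inv G.T_perfect] two
    by (intro perfect_hom_lie_algebra.intro perfect_hom_lie_algebra_axioms.intro)
  have "hom_lie_isomorphic K V (star_square K ?U)"
    using universal_central_extension_unique[OF V U.T_universal U.T_universal]
    by (auto simp: hom_lie_isomorphic_def)
  \<comment> \<open>Over \<open>W\<close> the algebra \<open>W \<star> W\<close> is universal;
    through \<open>f\<close> it has the same base as the tensor square of
    \<open>G \<star> G\<close>, so the two can be compared.\<close>
  moreover note W_universal =
    universal_central_extension_compose[OF W.T_universal G.T_hom_lie_algebra f]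
  have "hom_lie_isomorphic K (star_square K ?U) (star_square K W)"
    using universal_central_extension_unique[OF U.T_universal U.T_universal W_universal W_universal]
    by (auto simp: hom_lie_isomorphic_def)
  ultimately show "hom_lie_isomorphic K V (star_square K W)"
    by (rule hom_lie_isomorphic_trans)
qed

end
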